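(* The (decision version of the) bottleneck pyramidal TSP on $n$ points in the Euclidean plane has a lower bound of $\Omega(n\log n)$ in the algebraic computation tree model: deciding, for a linearly ordered set $P$ of $n$ points in the plane and a value $B>0$, whether $P$ admits a pyramidal tour whose longest edge has Euclidean length at most $B$, requires $\Omega(n\log n)$ time in this model.
   Context: For a linear order $p_1,\ldots,p_n$ of the points, a pyramidal tour is a Hamiltonian cycle on the points of the form $(p_1,p_{i_1},\ldots,p_{i_r},p_n,p_{j_1},\ldots,p_{j_{n-r-2}})$ with $i_1<i_2<\cdots<i_r$ and $j_1>j_2>\cdots>j_{n-r-2}$. *)

theory Defs
  imports Complex_Main
begin

text \<open>A computation node appends a new real value to the list of values computed so far
  (initially the input vector). Available operations: +, -, *, /, square root and arbitrary
  real constants. Branching nodes test the sign of a previously computed value (<0, =0, >0).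
  Leaves answer yes/no. Division and square roots are total as in HOL
  (x/0 = 0, sqrt of a negative number = - sqrt of its absolute value); out-of-range indices
  read 0. These conventions only strengthen the model by at most a constant factor.\<close>

datatype aop = Add | Sub | Mul | Dvd

datatype act =
    Leaf bool
  | Op aop nat nat act
  | Cst real act
  | Sqr nat act
  | Br nat act act act

definition getv :: "real list \<Rightarrow> nat \<Rightarrow> real" where
  "getv vs i = (if i < length vs then vs ! i else 0)"

fun apply_aop :: "aop \<Rightarrow> real \<Rightarrow> real \<Rightarrow> real" where
  "apply_aop Add x y = x + y"
| "apply_aop Sub x y = x - y"
| "apply_aop Mul x y = x * y"
| "apply_aop Dvd x y = x / y"

fun run_act :: "act \<Rightarrow> real list \<Rightarrow> bool" where
  "run_act (Leaf b) vs = b"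
| "run_act (Op f i j t) vs = run_act t (vs @ [apply_aop f (getv vs i) (getv vs j)])"
| "run_act (Cst c t) vs = run_act t (vs @ [c])"
| "run_act (Sqr i t) vs = run_act t (vs @ [sqrt (getv vs i)])"
| "run_act (Br i tlt te tg) vs =
     (if getv vs i < 0 then run_act tlt vs
      else if getv vs i = 0 then run_act te vs else run_act tg vs)"

fun act_depth :: "act \<Rightarrow> nat" where
  "act_depth (Leaf b) = 0"
| "act_depth (Op f i j t) = Suc (act_depth t)"
| "act_depth (Cst c t) = Suc (act_depth t)"
| "act_depth (Sqr i t) = Suc (act_depth t)"
| "act_depth (Br i tlt te tg) = Suc (max (act_depth tlt) (max (act_depth te) (act_depth tg)))"

definition edist :: "real \<times> real \<Rightarrow> real \<times> real \<Rightarrow> real" where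
  "edist p q = sqrt ((fst p - fst q)^2 + (snd p - snd q)^2)"

text \<open>A pyramidal tour on points indexed 0..n-1 (in their linear order), as a list of
  indices: it starts at 0, visits an increasing sequence, then n-1, then a decreasing
  sequence, and visits every index exactly once.\<close>
definition pyramidal_tour :: "nat \<Rightarrow> nat list \<Rightarrow> bool" where
  "pyramidal_tour n tour \<longleftrightarrow>
     distinct tour \<and> set tour = {0..<n} \<and>
     (\<exists>xs ys. tour = [0] @ xs @ [n - 1] @ ys \<and>
        sorted_wrt (<) xs \<and> sorted_wrt (>) ys)"

definition cycle_edges :: "nat list \<Rightarrow> (nat \<times> nat) list" where
  "cycle_edges tour = zip tour (tl tour @ [hd tour])"

definition bottleneck_pyramidal :: "(real \<times> real) list \<Rightarrow> real \<Rightarrow> bool" where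
  "bottleneck_pyramidal ps B \<longleftrightarrow>
     (\<exists>tour. pyramidal_tour (length ps) tour \<and>
        (\<forall>(i, j) \<in> set (cycle_edges tour). edist (ps ! i) (ps ! j) \<le> B))"

definition encode_input :: "(real \<times> real) list \<Rightarrow> real \<Rightarrow> real list" where
  "encode_input ps B = concat (map (\<lambda>p. [fst p, snd p]) ps) @ [B]"

definition decides_bpt :: "nat \<Rightarrow> act \<Rightarrow> bool" where
  "decides_bpt n T \<longleftrightarrow>
     (\<forall>ps B. length ps = n \<and> distinct ps \<and> B > 0 \<longrightarrow>
        (run_act T (encode_input ps B) \<longleftrightarrow> bottleneck_pyramidal ps B))"

end

theory Submission
  imports Defs "HOL-Analysis.Analysis"
begin

text \<open>
  The YES-set is a union of at most \<open>2 ^ n\<close> convex sets, one per tour, so the lower bound has to come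
  from the topology of the NO-set. Fix all points except \<open>m\<close> of them, each of which slides along a
  horizontal line. In the configuration below a short tour exists iff some sliding point is close to
  one of \<open>L\<close> fixed abscissae, so the NO-instances contain \<open>(L - 1) ^ m\<close> open boxes whose boundaries
  consist of YES-instances.

  Adding one or two coordinates per node, the inputs that follow a given path of the tree become the
  projection of the zero set of a sum of squares of polynomials of degree at most 3. A Milnor--Thom
  type bound shows that each path accounts for at most \<open>7 ^ N\<close> boxes, where \<open>N\<close> is the number of
  coordinates; as there are at most \<open>3 ^ h\<close> paths, \<open>(L - 1) ^ m\<close> is at most exponential in the depth
  \<open>h\<close> plus \<open>n\<close>, and \<open>m\<close> and \<open>L\<close> can both be taken about \<open>n / 2\<close>.
\<close>

section \<open>Polynomial functions\<close>

text \<open>Gaussian elimination, removing one equation and one unknown at a time. Below it yields a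
  nonzero weight on a finite point set that annihilates prescribed monomials.\<close>

lemma exists_nontrivial_relation:
  fixes A :: "'m \<Rightarrow> 'x \<Rightarrow> real"
  assumes "finite M" "finite X" "card M < card X"
  shows "\<exists>c. (\<exists>x\<in>X. c x \<noteq> 0) \<and> (\<forall>m\<in>M. (\<Sum>x\<in>X. A m x * c x) = 0)"
  using assms
proof (induction M arbitrary: A X rule: finite_induct)
  case empty
  then have "X \<noteq> {}" by auto
  then show ?case by (intro exI[of _ "\<lambda>_. 1"]) auto
next
  case (insert m M)
  show ?case
  proof (cases "\<forall>x\<in>X. A m x = 0")
    case True
    have "card M < card X" using insert by simp
    then obtain c where "\<exists>x\<in>X. c x \<noteq> 0" "\<forall>m\<in>M. (\<Sum>x\<in>X. A m x * c x) = 0"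
      using insert.IH[OF insert.prems(1)] by blast
    then show ?thesis using True by (intro exI[of _ c]) auto
  next
    case False
    then obtain x0 where x0: "x0 \<in> X" "A m x0 \<noteq> 0" by blast
    let ?X = "X - {x0}"
    let ?A = "\<lambda>m' x. A m' x - A m' x0 * A m x / A m x0"
    have "card M < card ?X" using insert x0 by simp
    then obtain c where c: "\<exists>x\<in>?X. c x \<noteq> 0" "\<forall>m\<in>M. (\<Sum>x\<in>?X. ?A m x * c x) = 0"
      using insert.IH[of ?X ?A] insert.prems(1) by blast
    \<comment> \<open>The value at the pivot \<open>x0\<close> is chosen to satisfy equation
      \<open>m\<close>; substituting it turns every other equation into one for
      \<open>?A\<close>.\<close>
    define c' where "c' = c(x0 := - (\<Sum>x\<in>?X. A m x * c x) / A m x0)"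
    have split: "(\<Sum>x\<in>X. A m' x * c' x) =
        (\<Sum>x\<in>?X. A m' x * c x) - A m' x0 * (\<Sum>x\<in>?X. A m x * c x) / A m x0" for m'
    proof -
      have "(\<Sum>x\<in>X. A m' x * c' x) = A m' x0 * c' x0 + (\<Sum>x\<in>?X. A m' x * c' x)"
        using x0 insert.prems(1) by (simp add: sum.remove)
      also have "(\<Sum>x\<in>?X. A m' x * c' x) = (\<Sum>x\<in>?X. A m' x * c x)"
        by (rule sum.cong) (auto simp: c'_def)
      finally show ?thesis by (simp add: c'_def)
    qed
    have "(\<Sum>x\<in>X. A m' x * c' x) = (\<Sum>x\<in>?X. ?A m' x * c x)" for m'
      unfolding split
      by (simp add: sum_subtractf left_diff_distrib sum_distrib_left sum_divide_distrib mult.assoc)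
    then have "\<forall>m'\<in>M. (\<Sum>x\<in>X. A m' x * c' x) = 0" using c(2) by simp
    moreover have "(\<Sum>x\<in>X. A m x * c' x) = 0" using x0 by (simp add: split)
    moreover have "\<exists>x\<in>X. c' x \<noteq> 0" using c(1) by (auto simp: c'_def)
    ultimately show ?thesis by (intro exI[of _ c']) auto
  qed
qed

text \<open>Polynomials as the span of monomials, so that linear claims need checking on monomials
  only. Points are functions on all of \<open>nat\<close>, which lets coordinates be added without a
  change of type.\<close>

inductive poly_fun :: "nat \<Rightarrow> nat \<Rightarrow> ((nat \<Rightarrow> real) \<Rightarrow> real) \<Rightarrow> bool" for N d where
  monomial: "(\<Sum>i<N. \<alpha> i) \<le> d \<Longrightarrow> poly_fun N d (\<lambda>x. \<Prod>i<N. x i ^ \<alpha> i)"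
| scale: "poly_fun N d f \<Longrightarrow> poly_fun N d (\<lambda>x. c * f x)"
| add: "poly_fun N d f \<Longrightarrow> poly_fun N d g \<Longrightarrow> poly_fun N d (\<lambda>x. f x + g x)"

lemma poly_fun_cong_vars:
  assumes "poly_fun N d f" "\<And>i. i < N \<Longrightarrow> x i = y i"
  shows "f x = f y"
  using assms by induction simp_all

lemma poly_fun_mono:
  assumes "poly_fun N d f" "N \<le> N'" "d \<le> d'"
  shows "poly_fun N' d' f"
  using assms(1)
proof induction
  case (monomial \<alpha>)
  define \<beta> where "\<beta> = (\<lambda>i. if i < N then \<alpha> i else 0)"
  have "(\<Sum>i<N'. \<beta> i) = (\<Sum>i<N. \<alpha> i)"
    by (rule sum.mono_neutral_cong_right) (use assms(2) in \<open>auto simp: \<beta>_def\<close>)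
  then have "poly_fun N' d' (\<lambda>x. \<Prod>i<N'. x i ^ \<beta> i)"
    using monomial assms(3) by (intro poly_fun.monomial) simp
  moreover have "(\<Prod>i<N'. x i ^ \<beta> i) = (\<Prod>i<N. x i ^ \<alpha> i)" for x :: "nat \<Rightarrow> real"
    by (rule prod.mono_neutral_cong_right) (use assms(2) in \<open>auto simp: \<beta>_def\<close>)
  ultimately show ?case by simp
qed (auto intro: poly_fun.intros)

lemma poly_fun_const: "poly_fun N d (\<lambda>x. c)"
  using scale[OF monomial[where \<alpha> = "\<lambda>_. 0"], of N d c] by simp

lemma poly_fun_var:
  assumes "i < N" "1 \<le> d"
  shows "poly_fun N d (\<lambda>x. x i)"
proof -
  have "(\<Prod>j<N. x j ^ (if j = i then 1 else 0)) = x i" for x :: "nat \<Rightarrow> real"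
    using assms by (subst prod.remove[of _ i]) auto
  moreover have "poly_fun N d (\<lambda>x. \<Prod>j<N. x j ^ (if j = i then 1 else 0))"
    by (rule monomial) (use assms in simp)
  ultimately show ?thesis by simp
qed

lemma poly_fun_diff:
  assumes "poly_fun N d f" "poly_fun N d g"
  shows "poly_fun N d (\<lambda>x. f x - g x)"
  using add[OF assms(1) scale[OF assms(2), of "-1"]] by simp

lemma poly_fun_mult:
  assumes "poly_fun N d f" "poly_fun N e g"
  shows "poly_fun N (d + e) (\<lambda>x. f x * g x)"
  using assms(1)
proof induction
  case (monomial \<alpha>)
  from assms(2) show ?case
  proof induction
    case (monomial \<beta>)
    have "poly_fun N (d + e) (\<lambda>x. \<Prod>i<N. x i ^ (\<alpha> i + \<beta> i))"
      by (rule poly_fun.monomial)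
        (use monomial \<open>(\<Sum>i<N. \<alpha> i) \<le> d\<close> in \<open>simp add: sum.distrib\<close>)
    then show ?case by (simp add: power_add prod.distrib)
  next
    case (scale g c)
    then show ?case using poly_fun.scale[OF scale.IH, of c] by (simp add: mult.left_commute)
  next
    case (add g h)
    then show ?case using poly_fun.add[OF add.IH] by (simp add: distrib_left)
  qed
next
  case (scale f c)
  then show ?case using poly_fun.scale[OF scale.IH, of c] by (simp add: mult.assoc)
next
  case (add f h)
  then show ?case using poly_fun.add[OF add.IH] by (simp add: distrib_right)
qed

lemma poly_fun_power:
  assumes "poly_fun N d f"
  shows "poly_fun N (n * d) (\<lambda>x. f x ^ n)"
proof (induction n)
  case 0
  show ?case using poly_fun_const[of N 0 1] by simp
next
  case (Suc n)
  show ?case using poly_fun_mult[OF assms Suc] by simp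
qed

lemma poly_fun_sum:
  assumes "\<And>i. i \<in> I \<Longrightarrow> poly_fun N d (f i)"
  shows "poly_fun N d (\<lambda>x. \<Sum>i\<in>I. f i x)"
  using assms
  by (induction I rule: infinite_finite_induct) (auto intro: poly_fun_const add)

lemma poly_fun_continuous: "poly_fun N d f \<Longrightarrow> continuous_on A f"
  by (induction rule: poly_fun.induct)
    (auto intro!: continuous_intros intro: continuous_on_product_coordinates continuous_on_subset)

lemma poly_fun_partial_derivative:
  assumes "poly_fun N d f"
  shows "\<exists>f'. poly_fun N (d - 1) f' \<and>
    (\<forall>x. ((\<lambda>t. f (x(i := t))) has_real_derivative f' x) (at (x i)))"
  using assms
proof induction
  case (monomial \<alpha>)
  show ?case
  proof (cases "i < N \<and> \<alpha> i \<noteq> 0")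
    case False
    \<comment> \<open>Without the variable the derivative is 0; this includes \<open>d = 0\<close>,
      where \<open>d - 1\<close> is truncated.\<close>
    have "(\<lambda>t. \<Prod>j<N. (x(i := t)) j ^ \<alpha> j) = (\<lambda>t. \<Prod>j<N. x j ^ \<alpha> j)" for x :: "nat \<Rightarrow> real"
      by (intro ext prod.cong) (use False in auto)
    then show ?thesis by (intro exI[of _ "\<lambda>_. 0"]) (simp add: poly_fun_const)
  next
    case True
    define \<beta> where "\<beta> = \<alpha>(i := \<alpha> i - 1)"
    have "(\<Sum>j<N. \<alpha> j) = \<alpha> i + (\<Sum>j\<in>{..<N} - {i}. \<alpha> j)"
      using True by (intro sum.remove) auto
    moreover have "(\<Sum>j<N. \<beta> j) = (\<alpha> i - 1) + (\<Sum>j\<in>{..<N} - {i}. \<alpha> j)"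
      using True by (subst sum.remove[of _ i]) (auto simp: \<beta>_def intro!: sum.cong)
    ultimately have "poly_fun N (d - 1) (\<lambda>x. real (\<alpha> i) * (\<Prod>j<N. x j ^ \<beta> j))"
      using True monomial by (intro scale poly_fun.monomial) linarith
    moreover have "((\<lambda>t. \<Prod>j<N. (x(i := t)) j ^ \<alpha> j) has_real_derivative
        real (\<alpha> i) * (\<Prod>j<N. x j ^ \<beta> j)) (at (x i))" for x :: "nat \<Rightarrow> real"
    proof -
      define P where "P = (\<Prod>j\<in>{..<N} - {i}. x j ^ \<alpha> j)"
      have "(\<Prod>j<N. (x(i := t)) j ^ \<alpha> j) = t ^ \<alpha> i * P" for t
        using True by (subst prod.remove[of _ i]) (auto simp: P_def intro!: prod.cong)
      moreover have "(\<Prod>j<N. x j ^ \<beta> j) = x i ^ (\<alpha> i - 1) * P"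
        using True by (subst prod.remove[of _ i]) (auto simp: P_def \<beta>_def intro!: prod.cong)
      ultimately show ?thesis
        by (auto intro!: derivative_eq_intros)
    qed
    ultimately show ?thesis by blast
  qed
next
  case (scale f c)
  then obtain f' where "poly_fun N (d - 1) f'"
    "\<forall>x. ((\<lambda>t. f (x(i := t))) has_real_derivative f' x) (at (x i))" by blast
  then show ?case
    by (intro exI[of _ "\<lambda>x. c * f' x"] conjI allI poly_fun.scale DERIV_cmult) blast+
next
  case (add f g)
  then obtain f' g' where "poly_fun N (d - 1) f'" "poly_fun N (d - 1) g'"
    "\<forall>x. ((\<lambda>t. f (x(i := t))) has_real_derivative f' x) (at (x i))"
    "\<forall>x. ((\<lambda>t. g (x(i := t))) has_real_derivative g' x) (at (x i))" by blast
  then show ?case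
    by (intro exI[of _ "\<lambda>x. f' x + g' x"] conjI allI poly_fun.add DERIV_add) blast+
qed

text \<open>On \<open>X\<close>, replacing \<open>x i ^ E\<close> by \<open>r x\<close> lowers the
  degree, so every polynomial agrees with a combination of the \<open>E ^ N\<close> monomials with
  all exponents below \<open>E\<close>. Polynomials separate the points of \<open>X\<close>, hence
  interpolate every function on it, a space of dimension \<open>card X\<close>. The proof is the
  dual form of this count.\<close>

lemma card_le_of_power_reduction:
  assumes fin: "finite X"
    and sep: "\<And>x y. x \<in> X \<Longrightarrow> y \<in> X \<Longrightarrow> x \<noteq> y \<Longrightarrow> \<exists>i<N. x i \<noteq> y i"
    and red: "\<And>i. i < N \<Longrightarrow> \<exists>r. poly_fun N d r \<and> (\<forall>x\<in>X. x i ^ E = r x)"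
    and deg: "d < E"
  shows "card X \<le> E ^ N"
proof (rule ccontr)
  assume "\<not> card X \<le> E ^ N"
  moreover define M where "M = (\<Pi>\<^sub>E i\<in>{..<N}. {..<E})"
  have "card M = E ^ N" "finite M" by (simp_all add: M_def card_PiE finite_PiE)
  \<comment> \<open>\<open>c\<close> is a nonzero functional on functions on \<open>X\<close> that
    kills all reduced monomials.\<close>
  ultimately obtain c where nz: "\<exists>x\<in>X. c x \<noteq> 0"
    and c: "\<forall>\<alpha>\<in>M. (\<Sum>x\<in>X. (\<Prod>i<N. x i ^ \<alpha> i) * c x) = 0"
    using exists_nontrivial_relation[of M X "\<lambda>\<alpha> x. \<Prod>i<N. x i ^ \<alpha> i"] fin by auto
  have extend: "(\<Sum>x\<in>X. f x * c x) = 0"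
    if "poly_fun N e f"
      and "\<And>\<alpha>. (\<Sum>i<N. \<alpha> i) \<le> e \<Longrightarrow> (\<Sum>x\<in>X. (\<Prod>i<N. x i ^ \<alpha> i) * c x) = 0" for f e
    using that(1)
  proof induction
    case (monomial \<alpha>)
    then show ?case by (rule that(2))
  next
    case (scale f k)
    then show ?case by (simp add: mult.assoc flip: sum_distrib_left)
  next
    case (add f g)
    then show ?case by (simp add: distrib_right sum.distrib)
  qed
  \<comment> \<open>Induction on total degree: factoring out \<open>x i ^ E\<close> and substituting
    \<open>r\<close> leaves a polynomial of smaller degree, to which \<open>extend\<close>
    applies.\<close>
  have mon: "(\<Sum>x\<in>X. (\<Prod>i<N. x i ^ \<alpha> i) * c x) = 0" for \<alpha>
  proof (induction "\<Sum>i<N. \<alpha> i" arbitrary: \<alpha> rule: less_induct)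
    case less
    show ?case
    proof (cases "\<forall>i<N. \<alpha> i < E")
      case True
      then have "restrict \<alpha> {..<N} \<in> M" by (auto simp: M_def)
      then show ?thesis using c by fastforce
    next
      case False
      then obtain i where i: "i < N" "E \<le> \<alpha> i" by (meson not_le)
      obtain r where r: "poly_fun N d r" "\<forall>x\<in>X. x i ^ E = r x" using red i by blast
      define \<beta> where "\<beta> = \<alpha>(i := \<alpha> i - E)"
      have "(\<Sum>j<N. \<alpha> j) = \<alpha> i + (\<Sum>j\<in>{..<N} - {i}. \<alpha> j)"
        using i by (intro sum.remove) auto
      moreover have "(\<Sum>j<N. \<beta> j) = (\<alpha> i - E) + (\<Sum>j\<in>{..<N} - {i}. \<alpha> j)"
        using i by (subst sum.remove[of _ i]) (auto simp: \<beta>_def intro!: sum.cong)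
      ultimately have lt: "(\<Sum>j<N. \<beta> j) + d < (\<Sum>j<N. \<alpha> j)" using i deg by linarith
      have eq: "(\<Prod>j<N. x j ^ \<alpha> j) = (\<Prod>j<N. x j ^ \<beta> j) * r x" if "x \<in> X" for x
      proof -
        define P where "P = (\<Prod>j\<in>{..<N} - {i}. x j ^ \<alpha> j)"
        have "(\<Prod>j<N. x j ^ \<alpha> j) = x i ^ \<alpha> i * P"
          using i by (subst prod.remove[of _ i]) (auto simp: P_def)
        also have "x i ^ \<alpha> i = x i ^ (\<alpha> i - E) * x i ^ E"
          using i by (simp flip: power_add)
        also have "x i ^ E = r x" using r that by blast
        finally have "(\<Prod>j<N. x j ^ \<alpha> j) = x i ^ (\<alpha> i - E) * P * r x" by simp
        also have "x i ^ (\<alpha> i - E) * P = (\<Prod>j<N. x j ^ \<beta> j)"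
          using i by (subst prod.remove[of _ i]) (auto simp: P_def \<beta>_def intro!: prod.cong)
        finally show ?thesis .
      qed
      have "poly_fun N ((\<Sum>j<N. \<beta> j) + d) (\<lambda>x. (\<Prod>j<N. x j ^ \<beta> j) * r x)"
        by (intro poly_fun_mult monomial r) simp
      then have "(\<Sum>x\<in>X. ((\<Prod>j<N. x j ^ \<beta> j) * r x) * c x) = 0"
        by (rule extend) (use less lt in auto)
      then show ?thesis using eq by simp
    qed
  qed
  have poly: "(\<Sum>x\<in>X. f x * c x) = 0" if "poly_fun N e f" for f e
    using extend[OF that] mon by blast
  from nz obtain x0 where x0: "x0 \<in> X" "c x0 \<noteq> 0" by blast
  \<comment> \<open>A product of linear factors isolates \<open>x0\<close>; applying the functional
    to it contradicts \<open>c x0 \<noteq> 0\<close>.\<close>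
  have interp: "\<exists>e q. poly_fun N e q \<and> q x0 \<noteq> 0 \<and> (\<forall>y\<in>Y. q y = 0)"
    if "finite Y" "Y \<subseteq> X - {x0}" for Y
    using that
  proof (induction Y rule: finite_induct)
    case empty
    then show ?case by (intro exI[of _ 0] exI[of _ "\<lambda>_. 1"]) (simp add: poly_fun_const)
  next
    case (insert y Y)
    then obtain e q where q: "poly_fun N e q" "q x0 \<noteq> 0" "\<forall>y\<in>Y. q y = 0" by blast
    obtain i where i: "i < N" "x0 i \<noteq> y i" using sep[of x0 y] insert x0 by auto
    have "poly_fun N (1 + e) (\<lambda>x. (x i - y i) * q x)"
      by (intro poly_fun_mult q poly_fun_diff poly_fun_var poly_fun_const i) simp
    then show ?case using q i by (intro exI[of _ "1 + e"] exI[of _ "\<lambda>x. (x i - y i) * q x"]) auto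
  qed
  obtain e q where q: "poly_fun N e q" "q x0 \<noteq> 0" "\<forall>y\<in>X - {x0}. q y = 0"
    using interp[of "X - {x0}"] fin by auto
  have "0 = (\<Sum>x\<in>X. q x * c x)" using poly[OF q(1)] by simp
  also have "\<dots> = q x0 * c x0" using q fin x0 by (simp add: sum.remove)
  finally show False using q x0 by simp
qed

section \<open>Separated zeros of a nonnegative polynomial\<close>

text \<open>Tychonoff's theorem: every one of the infinitely many coordinates is confined to an
  interval.\<close>

lemma compact_coordinate_box:
  fixes a b :: "nat \<Rightarrow> real"
  shows "compact {z. \<forall>i. z i \<in> {a i..b i}}"
proof -
  have "compactin (product_topology (\<lambda>_. euclidean) UNIV) (Pi\<^sub>E UNIV (\<lambda>i. {a i..b i}))"
    unfolding compactin_PiE by simp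
  moreover have "Pi\<^sub>E UNIV (\<lambda>i. {a i..b i}) = {z. \<forall>i. z i \<in> {a i..b i}}"
    by auto
  ultimately show ?thesis
    by (simp add: euclidean_product_topology)
qed

lemma compact_power_sum_sublevel:
  assumes "even D" "D > 0"
  shows "compact {z :: nat \<Rightarrow> real. (\<forall>i\<ge>N. z i = 0) \<and> (\<Sum>i<N. z i ^ D) \<le> R}"
proof -
  \<comment> \<open>Coordinates from \<open>N\<close> on are pinned to 0. For the others,
    \<open>\<bar>z i\<bar> > 1\<close> gives \<open>\<bar>z i\<bar> \<le> z i ^ D\<close>, whence
    the bound \<open>max 1 R\<close>.\<close>
  define b where "b = (\<lambda>i. if i < N then max 1 R else (0 :: real))"
  let ?K = "{z :: nat \<Rightarrow> real. (\<forall>i\<ge>N. z i = 0) \<and> (\<Sum>i<N. z i ^ D) \<le> R}"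
  have "?K = {z. \<forall>i. z i \<in> {- b i..b i}} \<inter> {z. (\<Sum>i<N. z i ^ D) \<le> R}"
  proof (intro set_eqI iffI)
    fix z :: "nat \<Rightarrow> real" assume z: "z \<in> ?K"
    have "\<bar>z i\<bar> \<le> max 1 R" if "i < N" for i
    proof (rule ccontr)
      assume "\<not> \<bar>z i\<bar> \<le> max 1 R"
      then have gt: "1 < \<bar>z i\<bar>" "R < \<bar>z i\<bar>" by auto
      have "R < \<bar>z i\<bar> ^ 1" using gt by simp
      also have "\<dots> \<le> \<bar>z i\<bar> ^ D" using gt assms by (intro power_increasing) auto
      also have "\<dots> = z i ^ D" using assms by (simp add: power_even_abs)
      also have "\<dots> \<le> (\<Sum>i<N. z i ^ D)"
        using that assms by (intro member_le_sum) (auto simp: zero_le_even_power)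
      finally show False using z by simp
    qed
    then have "z i \<in> {- b i..b i}" for i
      using z by (force simp: b_def abs_le_iff)
    then show "z \<in> {z. \<forall>i. z i \<in> {- b i..b i}} \<inter> {z. (\<Sum>i<N. z i ^ D) \<le> R}"
      using z by simp
  next
    fix z assume "z \<in> {z. \<forall>i. z i \<in> {- b i..b i}} \<inter> {z. (\<Sum>i<N. z i ^ D) \<le> R}"
    then have z: "\<And>i. - b i \<le> z i \<and> z i \<le> b i" "(\<Sum>i<N. z i ^ D) \<le> R" by auto
    have "z i = 0" if "i \<ge> N" for i using z(1)[of i] that by (simp add: b_def)
    then show "z \<in> ?K" using z by simp
  qed
  moreover have "closed {z :: nat \<Rightarrow> real. (\<Sum>i<N. z i ^ D) \<le> R}"
    by (intro closed_Collect_le continuous_intros continuous_on_product_coordinates)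
  ultimately show ?thesis
    using compact_coordinate_box[of "\<lambda>i. - b i" b] by (simp add: compact_Int_closed)
qed

text \<open>The perturbation \<open>g + \<epsilon> \<Sum> z\<^sub>i ^ (E + 1)\<close> is proper and, for small \<open>\<epsilon>\<close>, attains a local
  minimum in every region \<open>W k\<close>. At such a point \<open>z\<^sub>i ^ E\<close> equals a polynomial of degree less
  than \<open>E\<close> for each \<open>i\<close>, so there are at most \<open>E ^ N\<close> of them. This replaces Sard's and Bezout's
  theorems in the usual proof of the Milnor--Thom bound.\<close>

theorem card_separated_zeros_le:
  fixes W C :: "'k \<Rightarrow> (nat \<Rightarrow> real) set"
  assumes fin: "finite K"
    and g: "poly_fun N E g" "\<And>z. 0 \<le> g z" and E: "odd E"
    and W: "\<And>k. k \<in> K \<Longrightarrow> open (W k)" and C: "\<And>k. k \<in> K \<Longrightarrow> closed (C k)"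
    and WC: "\<And>k. k \<in> K \<Longrightarrow> W k \<subseteq> C k"
    and disj: "disjoint_family_on W K"
    and bd: "\<And>k z. k \<in> K \<Longrightarrow> z \<in> C k - W k \<Longrightarrow> g z \<noteq> 0"
    and v: "\<And>k. k \<in> K \<Longrightarrow> v k \<in> W k" "\<And>k. k \<in> K \<Longrightarrow> g (v k) = 0"
      "\<And>k i. k \<in> K \<Longrightarrow> N \<le> i \<Longrightarrow> v k i = 0"
  shows "card K \<le> E ^ N"
proof -
  \<comment> \<open>\<open>D\<close> is even, so \<phi> is nonnegative with compact sublevel sets in
    the first \<open>N\<close> coordinates, and its partial derivatives are multiples of
    \<open>z i ^ E\<close>.\<close>
  define D where "D = Suc E"
  have D: "even D" "D > 0" using E by (auto simp: D_def)
  define \<phi> where "\<phi> = (\<lambda>z :: nat \<Rightarrow> real. \<Sum>i<N. z i ^ D)"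
  have \<phi>0: "0 \<le> \<phi> z" for z
    unfolding \<phi>_def using D by (intro sum_nonneg) (simp add: zero_le_even_power)
  have \<phi>cont: "continuous_on A \<phi>" for A
    unfolding \<phi>_def
    by (intro continuous_intros continuous_on_subset[OF continuous_on_product_coordinates]) simp
  have gcont: "continuous_on A g" for A using g(1) by (rule poly_fun_continuous)
  define R where "R = 1 + (\<Sum>k\<in>K. \<phi> (v k))"
  have R: "\<phi> (v k) < R" if "k \<in> K" for k
  proof -
    have "\<phi> (v k) \<le> (\<Sum>k\<in>K. \<phi> (v k))" using that fin \<phi>0 by (intro member_le_sum) auto
    then show ?thesis by (simp add: R_def)
  qed
  have R0: "R > 0" using sum_nonneg[of K "\<lambda>k. \<phi> (v k)"] \<phi>0 by (simp add: R_def)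
  define Q where "Q = {z. (\<forall>i\<ge>N. z i = 0) \<and> \<phi> z \<le> R}"
  have Q: "compact Q"
    unfolding Q_def \<phi>_def using D by (rule compact_power_sum_sublevel)
  \<comment> \<open>\<open>g\<close> has a positive minimum on the compact boundary piece; an empty
    piece gets \<delta> = 1.\<close>
  have "\<exists>\<delta>>0. \<forall>z\<in>Q \<inter> (C k - W k). \<delta> \<le> g z" if k: "k \<in> K" for k
  proof (cases "Q \<inter> (C k - W k) = {}")
    case False
    have "compact (Q \<inter> (C k - W k))"
      using Q C[OF k] W[OF k] by (intro compact_Int_closed closed_Diff)
    then obtain z where z: "z \<in> Q \<inter> (C k - W k)" "\<forall>y\<in>Q \<inter> (C k - W k). g z \<le> g y"
      using continuous_attains_inf[OF _ False gcont] by blast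
    have "g z > 0" using bd[OF k, of z] g(2)[of z] z(1) by force
    then show ?thesis using z(2) by blast
  qed (auto intro: exI[of _ 1])
  then obtain \<delta> where \<delta>: "\<And>k. k \<in> K \<Longrightarrow> \<delta> k > 0"
      "\<And>k z. k \<in> K \<Longrightarrow> z \<in> Q \<inter> (C k - W k) \<Longrightarrow> \<delta> k \<le> g z"
    by metis
  \<comment> \<open>With this \<epsilon>, \<open>h (v k) < \<epsilon> * R \<le> \<delta> k\<close>:
    the minimum of \<open>h\<close> on \<open>Q \<inter> C k\<close> lies neither on the boundary of
    the region nor where \<open>\<phi> z = R\<close>.\<close>
  define \<epsilon> where "\<epsilon> = Min (insert 1 (\<delta> ` K)) / R"
  have "Min (insert 1 (\<delta> ` K)) > 0" using fin \<delta>(1) by simp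
  then have \<epsilon>0: "\<epsilon> > 0" using R0 by (simp add: \<epsilon>_def)
  have \<epsilon>R: "\<epsilon> * R \<le> \<delta> k" if "k \<in> K" for k
    using R0 fin that by (simp add: \<epsilon>_def)
  define h where "h = (\<lambda>z. g z + \<epsilon> * \<phi> z)"
  have hcont: "continuous_on A h" for A
    unfolding h_def by (intro continuous_intros gcont \<phi>cont)
  have "\<exists>z\<in>W k. (\<forall>i\<ge>N. z i = 0) \<and> \<phi> z < R \<and> (\<forall>y\<in>Q \<inter> C k. h z \<le> h y)"
    if k: "k \<in> K" for k
  proof -
    have vQ: "v k \<in> Q \<inter> C k" using v[OF k] k R[OF k] WC[OF k] by (auto simp: Q_def)
    have "compact (Q \<inter> C k)" using Q C[OF k] by (rule compact_Int_closed)
    then obtain z where z: "z \<in> Q \<inter> C k" "\<forall>y\<in>Q \<inter> C k. h z \<le> h y"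
      using continuous_attains_inf[OF _ _ hcont, of "Q \<inter> C k"] vQ by blast
    have "h z \<le> h (v k)" using z vQ by blast
    also have "\<dots> < \<epsilon> * R" using v(2)[OF k] R[OF k] \<epsilon>0 by (simp add: h_def)
    finally have hz: "h z < \<epsilon> * R" .
    have "\<epsilon> * \<phi> z < \<epsilon> * R" using hz g(2)[of z] by (simp add: h_def)
    then have "\<phi> z < R" using \<epsilon>0 by simp
    moreover have "g z < \<delta> k"
      using hz \<epsilon>R[OF k] mult_nonneg_nonneg[OF less_imp_le[OF \<epsilon>0] \<phi>0[of z]]
      unfolding h_def by linarith
    then have "z \<in> W k" using \<delta>(2)[OF k, of z] z(1) by force
    ultimately show ?thesis using z by (auto simp: Q_def)
  qed
  then obtain p where p: "\<And>k. k \<in> K \<Longrightarrow> p k \<in> W k"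
      "\<And>k i. k \<in> K \<Longrightarrow> N \<le> i \<Longrightarrow> p k i = 0" "\<And>k. k \<in> K \<Longrightarrow> \<phi> (p k) < R"
      "\<And>k y. k \<in> K \<Longrightarrow> y \<in> Q \<inter> C k \<Longrightarrow> h (p k) \<le> h y"
    by metis
  have "inj_on p K"
  proof (rule inj_onI)
    fix k l assume kl: "k \<in> K" "l \<in> K" "p k = p l"
    then have "p k \<in> W k \<inter> W l" using p(1) by (metis IntI)
    then show "k = l" using disj kl unfolding disjoint_family_on_def by blast
  qed
  then have "card K = card (p ` K)" by (simp add: card_image)
  also have "\<dots> \<le> E ^ N"
  proof (rule card_le_of_power_reduction[where d = "E - 1"])
    show "finite (p ` K)" using fin by simp
    show "E - 1 < E" using E by (cases E) auto
    show "\<exists>i<N. x i \<noteq> y i" if "x \<in> p ` K" "y \<in> p ` K" "x \<noteq> y" for x y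
    proof (rule ccontr)
      assume "\<not> (\<exists>i<N. x i \<noteq> y i)"
      moreover have "x i = 0 \<and> y i = 0" if "i \<ge> N" for i
        using p(2) that \<open>x \<in> p ` K\<close> \<open>y \<in> p ` K\<close> by auto
      ultimately have "x = y" by (metis ext not_le)
      with that show False by simp
    qed
    fix i assume i: "i < N"
    obtain g' where g': "poly_fun N (E - 1) g'"
      "\<And>x. ((\<lambda>t. g (x(i := t))) has_real_derivative g' x) (at (x i))"
      using poly_fun_partial_derivative[OF g(1)] by blast
    \<comment> \<open>The vanishing of the partial derivative of \<open>h\<close>, solved for
      \<open>z i ^ E\<close>.\<close>
    define r where "r = (\<lambda>x. (- 1 / (\<epsilon> * real D)) * g' x)"
    have "poly_fun N (E - 1) r" unfolding r_def by (rule poly_fun.scale[OF g'(1)])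
    moreover have "p k i ^ E = r (p k)" if k: "k \<in> K" for k
    proof -
      define z where "z = p k"
      define P where "P = (\<Sum>j\<in>{..<N} - {i}. z j ^ D)"
      have \<phi>z: "\<phi> (z(i := t)) = t ^ D + P" for t
        unfolding \<phi>_def P_def using i by (subst sum.remove[of _ i]) (auto intro!: sum.cong)
      have der: "((\<lambda>t. h (z(i := t))) has_real_derivative g' z + \<epsilon> * (real D * z i ^ E)) (at (z i))"
        unfolding h_def \<phi>z
        by (rule derivative_eq_intros g' refl | simp add: D_def)+
      have cupd: "continuous_on UNIV (\<lambda>t. z(i := t))"
      proof (rule continuous_on_coordinatewise_then_product)
        show "continuous_on UNIV (\<lambda>t. (z(i := t)) j)" for j
          by (cases "j = i") simp_all
      qed
      \<comment> \<open>Moving one coordinate slightly stays within \<open>W k\<close> and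
        \<open>\<phi> < R\<close>, where \<open>p k\<close> is minimal, so \<open>h\<close> has a
        local minimum along this line.\<close>
      have "open ((\<lambda>t. z(i := t)) -` (W k \<inter> {y. \<phi> y < R}))"
        by (intro open_vimage open_Int W k open_Collect_less \<phi>cont continuous_on_const cupd)
      moreover have "z i \<in> (\<lambda>t. z(i := t)) -` (W k \<inter> {y. \<phi> y < R})"
        using p(1,3)[OF k] by (simp add: z_def)
      ultimately obtain e where e: "e > 0"
          "\<And>t. dist t (z i) < e \<Longrightarrow> z(i := t) \<in> W k \<inter> {y. \<phi> y < R}"
        unfolding open_dist by (metis vimage_eq)
      have "h z \<le> h (z(i := t))" if "\<bar>z i - t\<bar> < e" for t
      proof -
        have "z(i := t) \<in> W k \<inter> {y. \<phi> y < R}"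
          using that by (intro e(2)) (simp add: dist_real_def abs_minus_commute)
        moreover have "\<forall>j\<ge>N. (z(i := t)) j = 0" using p(2)[OF k] i by (auto simp: z_def)
        ultimately have "z(i := t) \<in> Q \<inter> C k" using WC[OF k] by (auto simp: Q_def)
        then show ?thesis using p(4)[OF k] by (simp add: z_def)
      qed
      then have "g' z + \<epsilon> * (real D * z i ^ E) = 0"
        using DERIV_local_min[OF der e(1)] by simp
      then have "\<epsilon> * real D * z i ^ E = - g' z" by (simp add: mult.assoc)
      then show ?thesis using \<epsilon>0 D(2)
        unfolding r_def z_def by (simp add: field_simps)
    qed
    ultimately show "\<exists>r. poly_fun N (E - 1) r \<and> (\<forall>x\<in>p ` K. x i ^ E = r x)" by blast
  qed
  finally show ?thesis .
qed

section \<open>Algebraic computation trees\<close>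

lemma getv_map: "getv (map z idx) i = (if i < length idx then z (idx ! i) else 0)"
  by (simp add: getv_def)

lemma poly_fun_getv:
  assumes "set idx \<subseteq> {..<N}"
  shows "poly_fun N 1 (\<lambda>z. getv (map z idx) i)"
proof (cases "i < length idx")
  case True
  then have "idx ! i < N" using assms nth_mem by blast
  then show ?thesis using True by (simp add: getv_map poly_fun_var)
qed (simp add: getv_map poly_fun_const)

text \<open>Encodes a sign condition by an equation: \<open>y * w\<^sup>2 = 1\<close> is solvable in
  \<open>w\<close> exactly for positive \<open>y\<close>.\<close>

lemma pos_if_mult_square_eq_1:
  fixes y w :: real
  assumes "y * w\<^sup>2 = 1"
  shows "0 < y"
  using assms zero_le_power2[of w] by (metis mult_nonpos_nonneg not_le not_one_le_zero)

text \<open>In HOL \<open>sqrt\<close> is odd, so for negative \<open>x\<close> the value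
  \<open>y = sqrt x\<close> is the negative root of \<open>y\<^sup>2 = - x\<close>. The second
  equation certifies this sign, with witness \<open>sqrt (1 / sqrt x)\<close>.\<close>

lemma sqrt_neg_eqs:
  assumes "x < 0"
  shows "(sqrt x)\<^sup>2 + x = 0" "sqrt x * (sqrt (1 / sqrt x))\<^sup>2 + 1 = 0"
proof -
  obtain b where "x = - b" "b > 0" using assms by (metis add.inverse_inverse neg_0_less_iff_less)
  then show "(sqrt x)\<^sup>2 + x = 0" "sqrt x * (sqrt (1 / sqrt x))\<^sup>2 + 1 = 0"
    by (simp_all add: real_sqrt_minus)
qed

text \<open>The arithmetic of one induction step over the tree: a node splits the regions into at
  most three families and costs two coordinates. A node with fewer cases repeats a family.\<close>

lemma card_three_le:
  assumes "K = K1 \<union> K2 \<union> K3"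
    and "card K1 \<le> 3 ^ d1 * 7 ^ (N + 2 + 2 * d1)" "d1 \<le> d"
    and "card K2 \<le> 3 ^ d2 * 7 ^ (N + 2 + 2 * d2)" "d2 \<le> d"
    and "card K3 \<le> 3 ^ d3 * 7 ^ (N + 2 + 2 * d3)" "d3 \<le> d"
  shows "card K \<le> 3 ^ Suc d * 7 ^ (N + 2 * Suc d)"
proof -
  have le: "3 ^ d' * 7 ^ (N + 2 + 2 * d') \<le> (3 ^ d * 7 ^ (N + 2 + 2 * d) :: nat)" if "d' \<le> d" for d'
    using that by (intro mult_le_mono power_increasing) auto
  have "card K \<le> card K1 + card K2 + card K3"
    unfolding assms(1) by (meson card_Un_le add_le_mono order_trans order_refl)
  also have "\<dots> \<le> 3 * (3 ^ d * 7 ^ (N + 2 + 2 * d))"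
    using assms le[of d1] le[of d2] le[of d3] by linarith
  finally show ?thesis by simp
qed

lemma poly_fun_square: "poly_fun N 3 f \<Longrightarrow> poly_fun N 6 (\<lambda>z. (f z)\<^sup>2)"
  using poly_fun_power[of N 3 f 2] by simp

text \<open>\<open>W k\<close> only constrains the first \<open>M\<close> coordinates, the inputs,
  so later coordinates of a point can be set freely without leaving it. The points of
  \<open>C k - W k\<close> act as the boundary.\<close>

locale cylinder_regions =
  fixes M :: nat and W C :: "'k \<Rightarrow> (nat \<Rightarrow> real) set" and I :: "'k set"
  assumes finI: "finite I"
    and W_open: "k \<in> I \<Longrightarrow> open (W k)" and C_closed: "k \<in> I \<Longrightarrow> closed (C k)"
    and W_subset: "k \<in> I \<Longrightarrow> W k \<subseteq> C k"
    and W_disj: "disjoint_family_on W I"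
    and W_cyl: "k \<in> I \<Longrightarrow> z \<in> W k \<Longrightarrow> (\<And>i. i < M \<Longrightarrow> z i = z' i) \<Longrightarrow> z' \<in> W k"
begin

text \<open>The zero set of \<open>g\<close> encodes the inputs that reach the subtree \<open>T\<close>, together with auxiliary
  coordinates; the coordinates listed in \<open>idx\<close> hold the values computed so far. Every region in
  \<open>K\<close> contains a rejected point of the zero set and has all its boundary points in it accepted.\<close>

definition separates ::
  "act \<Rightarrow> nat \<Rightarrow> ((nat \<Rightarrow> real) \<Rightarrow> real) \<Rightarrow> nat list \<Rightarrow> 'k set \<Rightarrow> ('k \<Rightarrow> nat \<Rightarrow> real) \<Rightarrow> bool" where
  "separates T N g idx K v \<longleftrightarrow>
     K \<subseteq> I \<and> M \<le> N \<and> poly_fun N 6 g \<and> (\<forall>z. 0 \<le> g z) \<and> set idx \<subseteq> {..<N} \<and>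
     (\<forall>k\<in>K. v k \<in> W k \<and> g (v k) = 0 \<and> \<not> run_act T (map (v k) idx)) \<and>
     (\<forall>k\<in>K. \<forall>z\<in>C k - W k. g z = 0 \<longrightarrow> run_act T (map z idx))"

text \<open>The two new coordinates hold a computed value or a witness of a sign condition, and
  \<open>e\<close> relates them to the earlier ones. As both summands are nonnegative, zeros of the
  sum are common zeros, and \<open>run\<close> carries acceptance on the boundary over to
  \<open>T'\<close>.\<close>

lemma separates_step:
  assumes sep: "separates T N g idx K v"
    and e: "poly_fun (N + 2) 6 e" "\<And>z. 0 \<le> e z"
    and idx': "set idx' \<subseteq> {..<N + 2}" and K': "K' \<subseteq> K"
    and run: "\<And>z. e z = 0 \<Longrightarrow> run_act T' (map z idx') = run_act T (map z idx)"
    and root: "\<And>k. k \<in> K' \<Longrightarrow> e ((v k)(N := y k, Suc N := w k)) = 0"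
  shows "separates T' (N + 2) (\<lambda>z. g z + e z) idx' K' (\<lambda>k. (v k)(N := y k, Suc N := w k))"
proof -
  have s: "K \<subseteq> I" "M \<le> N" "poly_fun N 6 g" "\<forall>z. 0 \<le> g z" "set idx \<subseteq> {..<N}"
    and in_K: "\<forall>k\<in>K. v k \<in> W k \<and> g (v k) = 0 \<and> \<not> run_act T (map (v k) idx)"
    and bd: "\<forall>k\<in>K. \<forall>z\<in>C k - W k. g z = 0 \<longrightarrow> run_act T (map z idx)"
    using sep unfolding separates_def by simp_all
  let ?v = "\<lambda>k. (v k)(N := y k, Suc N := w k)"
  show ?thesis
    unfolding separates_def
  proof (intro conjI ballI allI impI)
    show "K' \<subseteq> I" using K' s(1) by (rule order_trans)
    show "M \<le> N + 2" using s(2) by simp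
    show "poly_fun (N + 2) 6 (\<lambda>z. g z + e z)"
      by (intro poly_fun.add e(1) poly_fun_mono[OF s(3)]) simp_all
    show "0 \<le> g z + e z" for z using s(4) e(2) by (simp add: add_nonneg_nonneg)
    show "set idx' \<subseteq> {..<N + 2}" by (rule idx')
  next
    fix k assume k': "k \<in> K'"
    then have k: "k \<in> K" "k \<in> I" using K' s(1) by auto
    have vk: "v k \<in> W k" "g (v k) = 0" "\<not> run_act T (map (v k) idx)" using in_K k by blast+
    have agree: "v k i = ?v k i" if "i < N" for i using that by simp
    show "?v k \<in> W k"
      by (rule W_cyl[OF k(2) vk(1)]) (rule agree, use s(2) in simp)
    have "g (?v k) = g (v k)" by (rule poly_fun_cong_vars[OF s(3)]) simp
    then show "g (?v k) + e (?v k) = 0" using vk(2) root[OF k'] by simp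
    have "map (?v k) idx = map (v k) idx" by (rule map_cong) (use s(5) in auto)
    then show "\<not> run_act T' (map (?v k) idx')"
      using vk(3) run[OF root[OF k']] by metis
  next
    fix k z assume k: "k \<in> K'" and z: "z \<in> C k - W k" "g z + e z = 0"
    have "0 \<le> g z" "0 \<le> e z" using s(4) e(2) by blast+
    then have "g z = 0" "e z = 0" using z(2) by linarith+
    moreover have "k \<in> K" using k K' by blast
    ultimately show "run_act T' (map z idx')" using bd z(1) run by blast
  qed
qed

text \<open>Each node distributes the regions by the case that \<open>v k\<close> falls into. At an
  accepting leaf no region can remain; at a rejecting leaf \<open>g\<close> has no zeros on the
  boundaries, and the count of separated zeros applies.\<close>

theorem card_separates_le:
  "separates T N g idx K v \<Longrightarrow> card K \<le> 3 ^ act_depth T * 7 ^ (N + 2 * act_depth T)"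
proof (induction T arbitrary: N g idx K v)
  case (Leaf b)
  have s: "K \<subseteq> I" "M \<le> N" "poly_fun N 6 g" "\<And>z. 0 \<le> g z"
    "\<And>k. k \<in> K \<Longrightarrow> v k \<in> W k \<and> g (v k) = 0 \<and> \<not> b"
    using Leaf by (simp_all add: separates_def)
  have bd: "\<forall>k\<in>K. \<forall>z\<in>C k - W k. g z = 0 \<longrightarrow> b"
    using Leaf unfolding separates_def run_act.simps by blast
  show ?case
  proof (cases b)
    case True
    then have "K = {}" using s(5) by blast
    then show ?thesis by simp
  next
    case False
    \<comment> \<open>Coordinates from \<open>N\<close> on are cleared; neither \<open>g\<close> nor
      \<open>W k\<close> depends on them.\<close>
    define u where "u = (\<lambda>k i. if i < N then v k i else 0)"
    have "card K \<le> 7 ^ N"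
    proof (rule card_separated_zeros_le[where g = g and W = W and C = C and v = u])
      show "finite K" using s(1) finI finite_subset by blast
      \<comment> \<open>The counting theorem wants an odd exponent, so degree 6 is raised to
        7.\<close>
      show "poly_fun N 7 g" using poly_fun_mono[OF s(3), of N 7] by simp
      show "disjoint_family_on W K"
        using W_disj s(1) by (rule disjoint_family_on_mono[rotated])
      show "g z \<noteq> 0" if "k \<in> K" "z \<in> C k - W k" for k z
        using bd that False by blast
      show "u k \<in> W k" if "k \<in> K" for k
        by (rule W_cyl[of k "v k"]) (use s(1,2) s(5)[OF that] that in \<open>auto simp: u_def\<close>)
      show "g (u k) = 0" if "k \<in> K" for k
      proof -
        have "g (u k) = g (v k)"
          by (rule poly_fun_cong_vars[OF s(3)]) (simp add: u_def)
        then show ?thesis using s(5)[OF that] by simp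
      qed
      show "open (W k)" "closed (C k)" "W k \<subseteq> C k" if "k \<in> K" for k
        using W_open C_closed W_subset s(1) that by blast+
    qed (simp_all add: s(4) u_def)
    then show ?thesis by simp
  qed
next
  case (Op f i j t)
  have idx: "set idx \<subseteq> {..<N}" using Op.prems by (simp add: separates_def)
  define a where "a = (\<lambda>z :: nat \<Rightarrow> real. getv (map z idx) i)"
  define b where "b = (\<lambda>z :: nat \<Rightarrow> real. getv (map z idx) j)"
  have ab: "poly_fun (N + 2) 1 a" "poly_fun (N + 2) 1 b"
    unfolding a_def b_def using poly_fun_mono[OF poly_fun_getv[OF idx]] by simp_all
  have upd: "map ((v k)(N := y, Suc N := w)) idx = map (v k) idx" for k y w
    by (rule map_cong) (use idx in auto)
  have a_upd: "a ((v k)(N := y, Suc N := w)) = a (v k)" for k y w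
    unfolding a_def upd ..
  have b_upd: "b ((v k)(N := y, Suc N := w)) = b (v k)" for k y w
    unfolding b_def upd ..
  have y: "poly_fun (N + 2) 1 (\<lambda>z. z N)" and w: "poly_fun (N + 2) 1 (\<lambda>z. z (Suc N))"
    by (intro poly_fun_var; simp)+
  have idx': "set (idx @ [N]) \<subseteq> {..<N + 2}" using idx by auto
  have run: "run_act t (map z (idx @ [N])) = run_act (Op f i j t) (map z idx)"
    if "z N = apply_aop f (a z) (b z)" for z
    using that by (simp add: a_def b_def)
  show ?case
  proof (cases "f = Dvd")
    case False
    have "poly_fun (N + 2) 3 (\<lambda>z. apply_aop f (a z) (b z))"
      using False poly_fun_mult[OF ab] ab[THEN poly_fun_mono, OF order_refl, of 3]
      by (cases f) (auto intro: poly_fun.add poly_fun_diff elim: poly_fun_mono)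
    then have e: "poly_fun (N + 2) 6 (\<lambda>z. (z N - apply_aop f (a z) (b z))\<^sup>2)"
      by (intro poly_fun_square poly_fun_diff poly_fun_mono[OF y]) auto
    have "card K \<le> 3 ^ act_depth t * 7 ^ (N + 2 + 2 * act_depth t)"
      by (rule Op.IH[OF separates_step[OF Op.prems e _ idx' order_refl run,
            where y = "\<lambda>k. apply_aop f (a (v k)) (b (v k))" and w = "\<lambda>_. 0"]])
        (simp_all add: a_upd b_upd fun_upd_same fun_upd_other del: fun_upd_apply)
    from card_three_le[OF _ this order_refl this order_refl this order_refl]
    show ?thesis by simp
  next
    case True
    \<comment> \<open>A zero denominator gives the value 0 by \<open>x / 0 = 0\<close>; otherwise
      the second coordinate is the inverse of the denominator and certifies that it is
      nonzero.\<close>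
    define K0 where "K0 = {k \<in> K. b (v k) = 0}"
    define K1 where "K1 = {k \<in> K. b (v k) \<noteq> 0}"
    have e0: "poly_fun (N + 2) 6 (\<lambda>z. (b z)\<^sup>2 + (z N)\<^sup>2)"
      by (intro poly_fun.add poly_fun_square poly_fun_mono[OF y] poly_fun_mono[OF ab(2)]) auto
    have c0: "card K0 \<le> 3 ^ act_depth t * 7 ^ (N + 2 + 2 * act_depth t)"
      by (rule Op.IH[OF separates_step[OF Op.prems e0 _ idx' _ run,
            where y = "\<lambda>_. 0" and w = "\<lambda>_. 0"]])
        (auto simp: fun_upd_same fun_upd_other a_upd b_upd K0_def True add_nonneg_eq_0_iff
        simp del: fun_upd_apply)
    have e1: "poly_fun (N + 2) 6 (\<lambda>z. (b z * z (Suc N) - 1)\<^sup>2 + (b z * z N - a z)\<^sup>2)"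
      by (intro poly_fun.add poly_fun_square poly_fun_diff poly_fun_const poly_fun_mono[OF ab(1)]
          poly_fun_mono[OF poly_fun_mult[OF ab(2) w]] poly_fun_mono[OF poly_fun_mult[OF ab(2) y]]) auto
    have c1: "card K1 \<le> 3 ^ act_depth t * 7 ^ (N + 2 + 2 * act_depth t)"
    proof (rule Op.IH[OF separates_step[OF Op.prems e1 _ idx' _ run,
            where y = "\<lambda>k. a (v k) / b (v k)" and w = "\<lambda>k. 1 / b (v k)"]])
      fix z assume "(b z * z (Suc N) - 1)\<^sup>2 + (b z * z N - a z)\<^sup>2 = 0"
      then have eq: "b z * z (Suc N) = 1" "b z * z N = a z" by (simp_all add: add_nonneg_eq_0_iff)
      then have "b z \<noteq> 0" by auto
      then show "z N = apply_aop f (a z) (b z)" using eq True by (simp add: field_simps)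
    qed (auto simp: fun_upd_same fun_upd_other a_upd b_upd K1_def
        simp del: fun_upd_apply)
    show ?thesis
      using card_three_le[OF _ c0 order_refl c1 order_refl c1 order_refl, of K]
      by (auto simp: K0_def K1_def)
  qed
next
  case (Cst c t)
  have idx: "set idx \<subseteq> {..<N}" using Cst.prems by (simp add: separates_def)
  have "poly_fun (N + 2) 6 (\<lambda>z. (z N - c)\<^sup>2)"
    by (intro poly_fun_square poly_fun_diff poly_fun_const poly_fun_var) auto
  then have "card K \<le> 3 ^ act_depth t * 7 ^ (N + 2 + 2 * act_depth t)"
    by (rule Cst.IH[OF separates_step[OF Cst.prems, where idx' = "idx @ [N]"
          and y = "\<lambda>_. c" and w = "\<lambda>_. 0"]]) (use idx in auto)
  from card_three_le[OF _ this order_refl this order_refl this order_refl]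
  show ?case by simp
next
  case (Sqr i t)
  have idx: "set idx \<subseteq> {..<N}" using Sqr.prems by (simp add: separates_def)
  define a where "a = (\<lambda>z :: nat \<Rightarrow> real. getv (map z idx) i)"
  have a: "poly_fun (N + 2) 1 a"
    unfolding a_def using poly_fun_mono[OF poly_fun_getv[OF idx]] by simp
  have upd: "map ((v k)(N := y, Suc N := w)) idx = map (v k) idx" for k y w
    by (rule map_cong) (use idx in auto)
  have a_upd: "a ((v k)(N := y, Suc N := w)) = a (v k)" for k y w
    unfolding a_def upd ..
  have y: "poly_fun (N + 2) 1 (\<lambda>z. z N)" and w: "poly_fun (N + 2) 1 (\<lambda>z. z (Suc N))"
    by (intro poly_fun_var; simp)+
  have idx': "set (idx @ [N]) \<subseteq> {..<N + 2}" using idx by auto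
  have run: "run_act t (map z (idx @ [N])) = run_act (Sqr i t) (map z idx)"
    if "z N = sqrt (a z)" for z
    using that by (simp add: a_def)
  have y2: "poly_fun (N + 2) 2 (\<lambda>z. (z N)\<^sup>2)"
    using poly_fun_power[OF y, of 2] by simp
  have yw2: "poly_fun (N + 2) 3 (\<lambda>z. z N * (z (Suc N))\<^sup>2)"
    using poly_fun_mult[OF y poly_fun_power[OF w, of 2]] by (simp add: numeral_3_eq_3)
  \<comment> \<open>Three cases by sign. For nonzero \<open>a\<close> the equation for the square
    leaves two candidates, and the second coordinate selects the root with the sign of
    \<open>a\<close>.\<close>
  define K0 where "K0 = {k \<in> K. a (v k) = 0}"
  define K1 where "K1 = {k \<in> K. a (v k) > 0}"
  define K2 where "K2 = {k \<in> K. a (v k) < 0}"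
  have e0: "poly_fun (N + 2) 6 (\<lambda>z. (a z)\<^sup>2 + (z N)\<^sup>2)"
    by (intro poly_fun.add poly_fun_square poly_fun_mono[OF y] poly_fun_mono[OF a]) auto
  have c0: "card K0 \<le> 3 ^ act_depth t * 7 ^ (N + 2 + 2 * act_depth t)"
    by (rule Sqr.IH[OF separates_step[OF Sqr.prems e0 _ idx' _ run,
          where y = "\<lambda>_. 0" and w = "\<lambda>_. 0"]])
      (auto simp: fun_upd_same fun_upd_other a_upd K0_def add_nonneg_eq_0_iff
        simp del: fun_upd_apply)
  have e1: "poly_fun (N + 2) 6 (\<lambda>z. ((z N)\<^sup>2 - a z)\<^sup>2 + (z N * (z (Suc N))\<^sup>2 - 1)\<^sup>2)"
    by (intro poly_fun.add poly_fun_square poly_fun_diff poly_fun_const poly_fun_mono[OF a]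
        poly_fun_mono[OF y2] yw2) auto
  have c1: "card K1 \<le> 3 ^ act_depth t * 7 ^ (N + 2 + 2 * act_depth t)"
  proof (rule Sqr.IH[OF separates_step[OF Sqr.prems e1 _ idx' _ run,
          where y = "\<lambda>k. sqrt (a (v k))" and w = "\<lambda>k. sqrt (1 / sqrt (a (v k)))"]])
    fix z assume "((z N)\<^sup>2 - a z)\<^sup>2 + (z N * (z (Suc N))\<^sup>2 - 1)\<^sup>2 = 0"
    then have eq: "(z N)\<^sup>2 = a z" "z N * (z (Suc N))\<^sup>2 = 1" by (simp_all add: add_nonneg_eq_0_iff)
    have "z N > 0" using eq(2) by (rule pos_if_mult_square_eq_1)
    then show "z N = sqrt (a z)" using eq(1) by (metis less_imp_le real_sqrt_unique)
  qed (auto simp: fun_upd_same fun_upd_other a_upd K1_def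
        simp del: fun_upd_apply)
  have e2: "poly_fun (N + 2) 6 (\<lambda>z. ((z N)\<^sup>2 + a z)\<^sup>2 + (z N * (z (Suc N))\<^sup>2 + 1)\<^sup>2)"
    by (intro poly_fun.add poly_fun_square poly_fun_const poly_fun_mono[OF a]
        poly_fun_mono[OF y2] yw2) auto
  have c2: "card K2 \<le> 3 ^ act_depth t * 7 ^ (N + 2 + 2 * act_depth t)"
  proof (rule Sqr.IH[OF separates_step[OF Sqr.prems e2 _ idx' _ run,
          where y = "\<lambda>k. sqrt (a (v k))" and w = "\<lambda>k. sqrt (1 / sqrt (a (v k)))"]])
    fix z assume "((z N)\<^sup>2 + a z)\<^sup>2 + (z N * (z (Suc N))\<^sup>2 + 1)\<^sup>2 = 0"
    then have eq: "(z N)\<^sup>2 + a z = 0" "z N * (z (Suc N))\<^sup>2 + 1 = 0"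
      by (simp_all add: add_nonneg_eq_0_iff)
    then have "(- z N)\<^sup>2 = - a z" "- z N * (z (Suc N))\<^sup>2 = 1" by simp_all
    moreover from this(2) have "- z N > 0" by (rule pos_if_mult_square_eq_1)
    ultimately have "sqrt (- a z) = - z N" by (metis less_imp_le real_sqrt_unique)
    then show "z N = sqrt (a z)" by (simp add: real_sqrt_minus)
  qed (auto simp: fun_upd_same fun_upd_other a_upd K2_def sqrt_neg_eqs
        simp del: fun_upd_apply)
  have "K = K0 \<union> K1 \<union> K2" by (auto simp: K0_def K1_def K2_def)
  from card_three_le[OF this c0 order_refl c1 order_refl c2 order_refl]
  show ?case by simp
next
  case (Br i t1 t2 t3)
  have idx: "set idx \<subseteq> {..<N}" using Br.prems by (simp add: separates_def)
  define a where "a = (\<lambda>z :: nat \<Rightarrow> real. getv (map z idx) i)"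
  have a: "poly_fun (N + 2) 1 a"
    unfolding a_def using poly_fun_mono[OF poly_fun_getv[OF idx]] by simp
  have upd: "map ((v k)(N := y, Suc N := w)) idx = map (v k) idx" for k y w
    by (rule map_cong) (use idx in auto)
  have a_upd: "a ((v k)(N := y, Suc N := w)) = a (v k)" for k y w
    unfolding a_def upd ..
  have idx': "set idx \<subseteq> {..<N + 2}" using idx by auto
  have "poly_fun (N + 2) 1 (\<lambda>z. z N)" by (intro poly_fun_var) simp_all
  from poly_fun_mult[OF a poly_fun_power[OF this, of 2]]
  have ay2: "poly_fun (N + 2) 3 (\<lambda>z. a z * (z N)\<^sup>2)" by (simp add: numeral_3_eq_3)
  \<comment> \<open>A branch computes nothing: coordinate \<open>N\<close> witnesses a nonzero sign
    and \<open>Suc N\<close> is filled with 0.\<close>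
  define K1 where "K1 = {k \<in> K. a (v k) < 0}"
  define K2 where "K2 = {k \<in> K. a (v k) = 0}"
  define K3 where "K3 = {k \<in> K. a (v k) > 0}"
  have e1: "poly_fun (N + 2) 6 (\<lambda>z. (a z * (z N)\<^sup>2 + 1)\<^sup>2)"
    by (intro poly_fun_square poly_fun.add poly_fun_const ay2)
  have c1: "card K1 \<le> 3 ^ act_depth t1 * 7 ^ (N + 2 + 2 * act_depth t1)"
  proof (rule Br.IH(1)[OF separates_step[OF Br.prems e1 _ idx',
          where y = "\<lambda>k. sqrt (1 / - a (v k))" and w = "\<lambda>k. 0"]])
    fix z assume "(a z * (z N)\<^sup>2 + 1)\<^sup>2 = 0"
    then have "a z * (z N)\<^sup>2 < 0" by simp
    then have "a z < 0" by (simp add: mult_less_0_iff)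
    then show "run_act t1 (map z idx) = run_act (Br i t1 t2 t3) (map z idx)"
      by (simp add: a_def)
  qed (auto simp: fun_upd_same fun_upd_other a_upd K1_def
        simp del: fun_upd_apply)
  have e2: "poly_fun (N + 2) 6 (\<lambda>z. (a z)\<^sup>2)"
    by (intro poly_fun_square poly_fun_mono[OF a]) auto
  have c2: "card K2 \<le> 3 ^ act_depth t2 * 7 ^ (N + 2 + 2 * act_depth t2)"
    by (rule Br.IH(2)[OF separates_step[OF Br.prems e2 _ idx',
          where y = "\<lambda>_. 0" and w = "\<lambda>_. 0"]])
      (auto simp: fun_upd_same fun_upd_other a_upd K2_def
        simp del: fun_upd_apply, simp_all add: a_def)
  have e3: "poly_fun (N + 2) 6 (\<lambda>z. (a z * (z N)\<^sup>2 - 1)\<^sup>2)"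
    by (intro poly_fun_square poly_fun_diff poly_fun_const ay2)
  have c3: "card K3 \<le> 3 ^ act_depth t3 * 7 ^ (N + 2 + 2 * act_depth t3)"
  proof (rule Br.IH(3)[OF separates_step[OF Br.prems e3 _ idx',
          where y = "\<lambda>k. sqrt (1 / a (v k))" and w = "\<lambda>k. 0"]])
    fix z assume "(a z * (z N)\<^sup>2 - 1)\<^sup>2 = 0"
    then have "a z * (z N)\<^sup>2 > 0" by simp
    then have "a z > 0" by (simp add: zero_less_mult_iff)
    then show "run_act t3 (map z idx) = run_act (Br i t1 t2 t3) (map z idx)"
      by (simp add: a_def)
  qed (auto simp: fun_upd_same fun_upd_other a_upd K3_def
        simp del: fun_upd_apply)
  have "K = K1 \<union> K2 \<union> K3" by (auto simp: K1_def K2_def K3_def)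
  from card_three_le[OF this c1 _ c2 _ c3, of "max (act_depth t1) (max (act_depth t2) (act_depth t3))"]
  show ?case by simp
qed

end

section \<open>The point configuration\<close>

lemma zip_shift_iff_successively:
  "(\<forall>(i, j)\<in>set (zip (x # xs) (xs @ [y])). R i j) \<longleftrightarrow> successively R (x # xs @ [y])"
  by (induction xs arbitrary: x) auto

lemma cycle_edges_iff_successively:
  "(\<forall>(i, j)\<in>set (cycle_edges (x # xs)). R i j) \<longleftrightarrow> successively R (x # xs @ [x])"
  unfolding cycle_edges_def by (simp add: zip_shift_iff_successively del: zip_Cons_Cons)

text \<open>Discrete intermediate value property: some step has to leave \<open>P\<close>.\<close>

lemma successively_crossing:
  assumes "successively R (x # xs @ [y])" "P x" "\<not> P y"
  shows "\<exists>a b. a \<in> set (x # xs) \<and> b \<in> set (xs @ [y]) \<and> R a b \<and> P a \<and> \<not> P b"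
  using assms
proof (induction xs arbitrary: x)
  case Nil
  then show ?case by auto
next
  case (Cons x' xs)
  show ?case
  proof (cases "P x'")
    case True
    then show ?thesis using Cons.IH[of x'] Cons.prems by auto
  next
    case False
    then show ?thesis using Cons.prems by (intro exI[of _ x] exI[of _ x']) auto
  qed
qed

lemma successively_if_all_pairs:
  "(\<And>x y. x \<in> set xs \<Longrightarrow> y \<in> set xs \<Longrightarrow> R x y) \<Longrightarrow> successively R xs"
  by (induction R xs rule: successively.induct) auto

lemma successively_join:
  assumes "successively R A" "successively R B" "successively R D" "A \<noteq> []" "B \<noteq> []"
    and "R (last A) c" "R c (hd B)" "R (last B) (hd D)"
  shows "successively R (A @ [c] @ B @ D)"
  using assms by (simp add: successively_append_iff successively_Cons)

text \<open>The ascending and the descending chain both run between 0 and \<open>n - 1\<close>, and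
  only one of them visits \<open>c\<close>; the other has to jump over it. The direction of the jump
  depends on the chain, hence the disjunction.\<close>

lemma pyramidal_tour_crossing:
  assumes tour: "pyramidal_tour n tour" and succ: "\<forall>(i, j)\<in>set (cycle_edges tour). R i j"
    and c: "0 < c" "c < n - 1"
  shows "\<exists>i j. i < c \<and> c < j \<and> j < n \<and> (R i j \<or> R j i)"
proof -
  obtain xs ys where t: "tour = [0] @ xs @ [n - 1] @ ys" and d: "distinct tour"
    and set: "set tour = {0..<n}"
    using tour unfolding pyramidal_tour_def by blast
  have "successively R (0 # (xs @ [n - 1] @ ys) @ [0])"
    using succ cycle_edges_iff_successively[of 0 "xs @ [n - 1] @ ys" R]
    unfolding t append_Cons append_Nil by blast
  then have "successively R ((0 # xs @ [n - 1]) @ (ys @ [0]))"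
    and "successively R ((0 # xs) @ ((n - 1) # ys @ [0]))" by simp_all
  then have s1: "successively R (0 # xs @ [n - 1])" and s2: "successively R ((n - 1) # ys @ [0])"
    by (simp_all only: successively_append_iff)
  have sub: "set xs \<subseteq> {0..<n}" "set ys \<subseteq> {0..<n}" unfolding set[symmetric] t by auto
  have n: "0 < n" using c by simp
  have "set xs \<inter> set ys = {}" using d unfolding t by auto
  then have "c \<notin> set xs \<or> c \<notin> set ys" by blast
  then show ?thesis
  proof
    assume nc: "c \<notin> set xs"
    obtain a b where "a \<in> set (0 # xs)" "b \<in> set (xs @ [n - 1])" "R a b" "a < c" "\<not> b < c"
      using successively_crossing[OF s1, of "\<lambda>i. i < c"] c by (meson less_asym)
    moreover from this(2) have "b \<noteq> c" "b < n" using nc c sub n by auto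
    ultimately show ?thesis by (metis linorder_neqE_nat)
  next
    assume nc: "c \<notin> set ys"
    obtain a b where "a \<in> set ((n - 1) # ys)" "b \<in> set (ys @ [0])" "R a b" "c < a" "\<not> c < b"
      using successively_crossing[OF s2, of "\<lambda>i. c < i"] c by (meson less_asym)
    moreover from this(1,2) have "b \<noteq> c" "a < n" using nc c sub n by auto
    ultimately show ?thesis by (metis linorder_neqE_nat)
  qed
qed

text \<open>The tour ascends through all indices except \<open>u\<close> and \<open>w\<close> and
  returns through \<open>w\<close> and then \<open>u\<close>; the chord is its only edge that jumps
  over \<open>m + 1\<close>.\<close>

lemma pyramidal_tour_through_chord:
  assumes m: "2 \<le> m" and L: "2 \<le> L"
    and u: "u \<in> {1..m}" and w: "w \<in> {m + 2..m + L + 1}" and chord: "R w u"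
    and lo: "\<And>i j. i \<le> m \<Longrightarrow> j \<le> m \<Longrightarrow> R i j"
    and hi: "\<And>i j. i \<in> {m + 2..m + L + 2} \<Longrightarrow> j \<in> {m + 2..m + L + 2} \<Longrightarrow> R i j"
    and mid: "\<And>i. i \<in> {1..m} \<Longrightarrow> R i (m + 1)" "\<And>j. j \<in> {m + 2..m + L + 1} \<Longrightarrow> R (m + 1) j"
  shows "\<exists>tour. pyramidal_tour (m + L + 3) tour \<and> (\<forall>(i, j)\<in>set (cycle_edges tour). R i j)"
proof -
  define X where "X = filter (\<lambda>i. i \<noteq> u) [1..<m + 1]"
  define Y where "Y = filter (\<lambda>i. i \<noteq> w) [m + 2..<m + L + 2]"
  have setX: "set X = {1..m} - {u}" and setY: "set Y = {m + 2..m + L + 1} - {w}"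
    by (auto simp: X_def Y_def)
  \<comment> \<open>With \<open>m\<close> and \<open>L\<close> at least 2, both parts of the ascent
    keep an element.\<close>
  have "(if u = 1 then 2 else 1) \<in> set X" "(if w = m + 2 then m + 3 else m + 2) \<in> set Y"
    unfolding setX setY using m L by auto
  then have ne: "X \<noteq> []" "Y \<noteq> []" by auto
  have dist: "distinct X" "distinct Y" and srt: "sorted_wrt (<) X" "sorted_wrt (<) Y"
    unfolding X_def Y_def by (simp_all only: distinct_filter distinct_upt sorted_wrt_filter sorted_wrt_upt)
  define tour where "tour = 0 # (X @ [m + 1] @ Y @ [m + L + 2] @ [w, u])"
  have "pyramidal_tour (m + L + 3) tour"
    unfolding pyramidal_tour_def
  proof (intro conjI exI)
    show "distinct tour" using dist u w by (auto simp: tour_def setX setY)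
    show "set tour = {0..<m + L + 3}" using u w by (auto simp: tour_def setX setY)
    show "tour = [0] @ (X @ [m + 1] @ Y) @ [m + L + 3 - 1] @ [w, u]" by (simp add: tour_def)
    show "sorted_wrt (<) (X @ [m + 1] @ Y)"
      using srt by (auto simp: sorted_wrt_append setX setY)
    show "sorted_wrt (>) [w, u]" using u w by simp
  qed
  moreover have "successively R ((0 # X) @ [m + 1] @ (Y @ [m + L + 2, w]) @ [u, 0])"
  proof -
    have "successively R (0 # X)"
      by (rule successively_if_all_pairs) (auto simp: setX intro!: lo)
    moreover have "successively R (Y @ [m + L + 2, w])"
      by (rule successively_if_all_pairs) (use w in \<open>auto simp: setY intro!: hi\<close>)
    moreover have "successively R [u, 0]" using u lo by simp
    moreover have "R (last (0 # X)) (m + 1)"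
      using ne(1) mid(1)[of "last X"] last_in_set[OF ne(1)] unfolding setX by simp
    moreover have "R (m + 1) (hd (Y @ [m + L + 2, w]))"
      using ne(2) mid(2)[of "hd Y"] hd_in_set[OF ne(2)] unfolding setY by simp
    ultimately show ?thesis
      by (intro successively_join) (assumption | simp add: chord)+
  qed
  then have "\<forall>(i, j)\<in>set (cycle_edges tour). R i j"
    unfolding tour_def cycle_edges_iff_successively by simp
  ultimately show ?thesis by blast
qed

section \<open>Distances in the configuration\<close>

lemma edist_le_one_iff: "edist p q \<le> 1 \<longleftrightarrow> (fst p - fst q)\<^sup>2 + (snd p - snd q)\<^sup>2 \<le> 1"
  unfolding edist_def by simp

lemma edist_gt_one:
  assumes "1 < \<bar>snd p - snd q\<bar>"
  shows "\<not> edist p q \<le> 1"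
proof -
  have "1 < (snd p - snd q)\<^sup>2" using assms power_strict_mono[of 1 "\<bar>snd p - snd q\<bar>" 2] by simp
  then show ?thesis unfolding edist_le_one_iff using zero_le_power2[of "fst p - fst q"] by linarith
qed

text \<open>Here 1/100 + 81/100 < 1. Once all abscissae lie in an interval of length 1/10, a height
  difference of at most 9/10 suffices.\<close>

lemma edist_le_one:
  assumes "\<bar>fst p - fst q\<bar> \<le> 1 / 10" "\<bar>snd p - snd q\<bar> \<le> 9 / 10"
  shows "edist p q \<le> 1"
proof -
  have "(fst p - fst q)\<^sup>2 \<le> (1 / 10)\<^sup>2" "(snd p - snd q)\<^sup>2 \<le> (9 / 10)\<^sup>2"
    using assms power_mono[OF assms(1), of 2] power_mono[OF assms(2), of 2] by simp_all
  then show ?thesis unfolding edist_le_one_iff by (simp add: power2_eq_square)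
qed

text \<open>The spacing of the fixed points, small enough that all \<open>L\<close> of them have
  abscissae in [0, 1/10].\<close>

definition gap :: "nat \<Rightarrow> nat \<Rightarrow> real" where
  "gap m L = 1 / (10 * real (m + L + 3))"

text \<open>For \<open>k \<ge> 1\<close> this is below half the spacing, so room remains between the
  intervals around neighbouring fixed abscissae.\<close>

definition radius :: "nat \<Rightarrow> nat \<Rightarrow> nat \<Rightarrow> real" where
  "radius m L k = gap m L / real (k + 2)"

text \<open>A start point, \<open>m\<close> movable points at height about 1, a connector, \<open>L\<close> fixed points on the
  horizontal axis, and an end point. The height \<open>sqrt (1 - (radius m L k)\<^sup>2)\<close> puts the \<open>k\<close>-th movable
  point within distance 1 of a fixed point iff their abscissae differ by at most \<open>radius m L k\<close>;
  the radii are distinct so that the points stay distinct wherever the movable points are.\<close>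

definition gadget :: "nat \<Rightarrow> nat \<Rightarrow> (nat \<Rightarrow> real) \<Rightarrow> nat \<Rightarrow> real \<times> real" where
  "gadget m L x k =
     (if k = 0 then (0, 8 / 5)
      else if k \<le> m then (x k, sqrt (1 - (radius m L k)\<^sup>2))
      else if k = m + 1 then (0, 1 / 2)
      else if k \<le> m + L + 1 then (gap m L * real (k - (m + 2)), 0)
      else (0, - 3 / 5))"

lemma gap_pos: "gap m L > 0" and gap_le: "gap m L * real L \<le> 1 / 10"
  by (simp_all add: gap_def field_simps)

lemma radius_pos: "radius m L k > 0"
  using gap_pos by (simp add: radius_def)

lemma radius_less: "1 \<le> k \<Longrightarrow> radius m L k < gap m L / 2"
  unfolding radius_def using gap_pos by (intro divide_strict_left_mono) simp_all

lemma radius_less_tenth: "radius m L k < 1 / 10"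
proof -
  have "radius m L k \<le> gap m L" unfolding radius_def using gap_pos[of m L] by (simp add: field_simps)
  also have "\<dots> < 1 / 10" by (simp add: gap_def field_simps)
  finally show ?thesis .
qed

lemma height_sq: "(sqrt (1 - (radius m L k)\<^sup>2))\<^sup>2 = 1 - (radius m L k)\<^sup>2"
  and height_bounds: "9 / 10 \<le> sqrt (1 - (radius m L k)\<^sup>2)" "sqrt (1 - (radius m L k)\<^sup>2) \<le> 1"
proof -
  have "(radius m L k)\<^sup>2 \<le> (1 / 10)\<^sup>2"
    using radius_pos[of m L k] radius_less_tenth[of m L k] by (intro power_mono) simp_all
  then have r: "(radius m L k)\<^sup>2 \<le> 1 / 100" by (simp add: power2_eq_square)
  then show "(sqrt (1 - (radius m L k)\<^sup>2))\<^sup>2 = 1 - (radius m L k)\<^sup>2" by simp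
  show "9 / 10 \<le> sqrt (1 - (radius m L k)\<^sup>2)"
    using r by (intro real_le_rsqrt) (simp add: power2_eq_square)
  show "sqrt (1 - (radius m L k)\<^sup>2) \<le> 1" by simp
qed

lemma radius_inj: "radius m L k = radius m L l \<Longrightarrow> k = l"
  using gap_pos[of m L] by (simp add: radius_def)

text \<open>Heights separate all points except the fixed ones at height 0, which differ in
  abscissa.\<close>

lemma distinct_gadget: "distinct (map (gadget m L x) [0..<m + L + 3])"
proof -
  define H where "H = (\<lambda>k. sqrt (1 - (radius m L k)\<^sup>2))"
  have H_fold: "sqrt (1 - (radius m L k)\<^sup>2) = H k" for k by (simp add: H_def)
  have H_inj: "H k = H l \<longleftrightarrow> k = l" for k l
    using radius_inj[of m L k l] radius_pos[of m L k] radius_pos[of m L l]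
    by (auto simp: H_def power2_eq_iff)
  have H_neq: "H k \<noteq> 8 / 5" "H k \<noteq> 1 / 2" "H k \<noteq> 0" "H k \<noteq> - 3 / 5" for k
    using height_bounds[of m L k] unfolding H_def by linarith+
  have gap: "gap m L \<noteq> 0" using gap_pos[of m L] by simp
  have "inj_on (gadget m L x) {0..<m + L + 3}"
  proof (rule inj_onI)
    fix k l assume kl: "k \<in> {0..<m + L + 3}" "l \<in> {0..<m + L + 3}" "gadget m L x k = gadget m L x l"
    then show "k = l"
      using H_inj H_neq H_neq[symmetric] gap
      unfolding gadget_def H_fold by (auto split: if_splits)
  qed
  then show ?thesis by (simp add: distinct_map)
qed

lemma gadget_close_iff:
  assumes "k \<in> {1..m}" "j < L"
  shows "edist (gadget m L x (m + 2 + j)) (gadget m L x k) \<le> 1 \<longleftrightarrow>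
    \<bar>x k - gap m L * real j\<bar> \<le> radius m L k"
proof -
  have "edist (gadget m L x (m + 2 + j)) (gadget m L x k) \<le> 1 \<longleftrightarrow>
      (x k - gap m L * real j)\<^sup>2 \<le> (radius m L k)\<^sup>2"
    unfolding edist_le_one_iff using assms
    by (simp add: gadget_def height_sq power2_commute)
  also have "\<dots> \<longleftrightarrow> \<bar>x k - gap m L * real j\<bar> \<le> radius m L k"
    using radius_pos[of m L k] by (simp add: abs_le_square_iff[symmetric])
  finally show ?thesis .
qed

lemma snd_gadget_upper:
  assumes "k \<le> m"
  shows "9 / 10 \<le> snd (gadget m L x k)" "snd (gadget m L x k) \<le> 8 / 5"
  using assms height_bounds(1)[of m L k] order_trans[OF height_bounds(2)[of m L k], of "8 / 5"]
  by (auto simp: gadget_def)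

lemma edist_commute: "edist p q = edist q p"
  by (simp add: edist_def power2_commute)

text \<open>The tour jumps over the connector. From the start point or to the end point such a jump
  has height difference above 1, so it joins a movable point to a fixed one.\<close>

lemma bottleneck_gadget_imp_close:
  assumes "bottleneck_pyramidal (map (gadget m L x) [0..<m + L + 3]) 1"
  shows "\<exists>k\<in>{1..m}. \<exists>j<L. \<bar>x k - gap m L * real j\<bar> \<le> radius m L k"
proof -
  let ?n = "m + L + 3"
  let ?p = "map (gadget m L x) [0..<?n]"
  obtain tour where "pyramidal_tour ?n tour"
    "\<forall>(i, j)\<in>set (cycle_edges tour). edist (?p ! i) (?p ! j) \<le> 1"
    using assms unfolding bottleneck_pyramidal_def by auto
  from pyramidal_tour_crossing[OF this, of "m + 1"]
  obtain i j where ij: "i < m + 1" "m + 1 < j" "j < ?n" "edist (?p ! j) (?p ! i) \<le> 1"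
    by (auto simp: edist_commute)
  then have close: "edist (gadget m L x j) (gadget m L x i) \<le> 1" by (simp del: upt_Suc)
  have "i \<noteq> 0"
  proof
    assume "i = 0"
    then have "1 < \<bar>snd (gadget m L x j) - snd (gadget m L x i)\<bar>"
      using ij by (simp add: gadget_def)
    then show False using edist_gt_one close by blast
  qed
  moreover have "j \<le> m + L + 1"
  proof (rule ccontr)
    assume "\<not> j \<le> m + L + 1"
    then have "1 < \<bar>snd (gadget m L x j) - snd (gadget m L x i)\<bar>"
      using ij \<open>i \<noteq> 0\<close> height_bounds[of m L i] by (simp add: gadget_def)
    then show False using edist_gt_one close by blast
  qed
  moreover obtain j' where j': "j = m + 2 + j'"
    using ij(2) by (metis Suc_eq_plus1 Suc_leI add_2_eq_Suc' le_Suc_ex)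
  ultimately have i: "i \<in> {1..m}" and "j' < L" using ij by auto
  moreover have "\<bar>x i - gap m L * real j'\<bar> \<le> radius m L i"
    using gadget_close_iff[OF i \<open>j' < L\<close>] close unfolding j' by blast
  ultimately show ?thesis by blast
qed

text \<open>The close pair serves as the chord of the explicit tour; heights differ by at most 9/10
  along every other edge used there.\<close>

lemma close_imp_bottleneck_gadget:
  assumes m: "2 \<le> m" and L: "2 \<le> L"
    and x: "\<And>k. k \<in> {1..m} \<Longrightarrow> 0 \<le> x k \<and> x k \<le> 1 / 10"
    and k: "k \<in> {1..m}" and j: "j < L" and close: "\<bar>x k - gap m L * real j\<bar> \<le> radius m L k"
  shows "bottleneck_pyramidal (map (gadget m L x) [0..<m + L + 3]) 1"
proof -
  let ?n = "m + L + 3"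
  let ?p = "map (gadget m L x) [0..<?n]"
  have p: "?p ! i = gadget m L x i" if "i < ?n" for i using that by (simp del: upt_Suc)
  have fst_bounds: "0 \<le> fst (gadget m L x i)" "fst (gadget m L x i) \<le> 1 / 10" for i
  proof -
    have "gap m L * real (i - (m + 2)) \<le> 1 / 10" if "i \<le> m + L + 1"
    proof -
      have "gap m L * real (i - (m + 2)) \<le> gap m L * real L"
        using that gap_pos[of m L] by (intro mult_left_mono) auto
      then show ?thesis using gap_le[of m L] by linarith
    qed
    then show "0 \<le> fst (gadget m L x i)" "fst (gadget m L x i) \<le> 1 / 10"
      using x[of i] gap_pos[of m L] by (auto simp: gadget_def)
  qed
  have near: "edist (?p ! i) (?p ! l) \<le> 1"
    if "i < ?n" "l < ?n" "\<bar>snd (gadget m L x i) - snd (gadget m L x l)\<bar> \<le> 9 / 10" for i l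
    unfolding p[OF that(1)] p[OF that(2)] using fst_bounds[of i] fst_bounds[of l] that(3)
    by (intro edist_le_one) linarith+
  have "\<exists>tour. pyramidal_tour ?n tour \<and>
      (\<forall>(i, l)\<in>set (cycle_edges tour). edist (?p ! i) (?p ! l) \<le> 1)"
  proof (rule pyramidal_tour_through_chord[OF m L k, of "m + 2 + j"])
    show "m + 2 + j \<in> {m + 2..m + L + 1}" using j by simp
    show "edist (?p ! (m + 2 + j)) (?p ! k) \<le> 1"
      using gadget_close_iff[OF k j] close k j p[of k] p[of "m + 2 + j"] by simp
    show "edist (?p ! i) (?p ! l) \<le> 1" if "i \<le> m" "l \<le> m" for i l
      using that snd_gadget_upper[of i m L x] snd_gadget_upper[of l m L x]
      by (intro near) linarith+
    show "edist (?p ! i) (?p ! l) \<le> 1"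
      if "i \<in> {m + 2..m + L + 2}" "l \<in> {m + 2..m + L + 2}" for i l
      using that by (intro near) (auto simp: gadget_def)
    show "edist (?p ! i) (?p ! (m + 1)) \<le> 1" if "i \<in> {1..m}" for i
    proof (rule near)
      have "snd (gadget m L x i) \<le> 1" using that height_bounds(2)[of m L i] by (simp add: gadget_def)
      moreover have "snd (gadget m L x (m + 1)) = 1 / 2" by (simp add: gadget_def)
      ultimately show "\<bar>snd (gadget m L x i) - snd (gadget m L x (m + 1))\<bar> \<le> 9 / 10"
        using snd_gadget_upper[of i m L x] that by simp
    qed (use that in auto)
    show "edist (?p ! (m + 1)) (?p ! i) \<le> 1" if "i \<in> {m + 2..m + L + 1}" for i
      using that by (intro near) (auto simp: gadget_def)
  qed
  then show ?thesis unfolding bottleneck_pyramidal_def by simp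
qed

section \<open>The lower bound\<close>

lemma encode_input_coordinates:
  "encode_input (map (\<lambda>k. (z (2 * k), z (2 * k + 1))) [0..<n]) b = map z [0..<2 * n] @ [b]"
  unfolding encode_input_def by (induction n) simp_all

definition gadget_coordinate :: "nat \<Rightarrow> nat \<Rightarrow> (nat \<Rightarrow> real) \<Rightarrow> nat \<Rightarrow> real" where
  "gadget_coordinate m L x i =
     (if i = 2 * (m + L + 3) then 1
      else if even i then fst (gadget m L x (i div 2)) else snd (gadget m L x (i div 2)))"

lemma encode_gadget:
  assumes "\<And>i. i < 2 * (m + L + 3) + 1 \<Longrightarrow> z i = gadget_coordinate m L x i"
  shows "map z [0..<2 * (m + L + 3) + 1] = encode_input (map (gadget m L x) [0..<m + L + 3]) 1"
proof -
  let ?n = "m + L + 3"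
  have "gadget m L x k = (z (2 * k), z (2 * k + 1))" if "k < ?n" for k
    using assms[of "2 * k"] assms[of "2 * k + 1"] that by (simp add: gadget_coordinate_def)
  then have "map (gadget m L x) [0..<?n] = map (\<lambda>k. (z (2 * k), z (2 * k + 1))) [0..<?n]"
    by (intro map_cong) auto
  moreover have "z (2 * ?n) = 1" using assms[of "2 * ?n"] by (simp add: gadget_coordinate_def)
  moreover have "map z [0..<2 * ?n + 1] = map z [0..<2 * ?n] @ [z (2 * ?n)]"
    by (simp only: add.right_neutral add_Suc_right One_nat_def upt_Suc_append le0 map_append list.map)
  ultimately show ?thesis by (simp only: encode_input_coordinates)
qed

text \<open>Each input coordinate is either a free abscissa or constant, hence of degree at most
  1.\<close>

lemma gadget_coordinate_cases:
  obtains k where "k \<in> {1..m}" "i = 2 * k" "\<And>x. gadget_coordinate m L x i = x k"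
  | c where "\<And>x. gadget_coordinate m L x i = c"
proof (cases "even i \<and> i div 2 \<in> {1..m}")
  case True
  then have "i div 2 \<in> {1..m}" "i = 2 * (i div 2)" by auto
  moreover from this have "gadget_coordinate m L x i = x (i div 2)" for x
    by (auto simp: gadget_coordinate_def gadget_def)
  ultimately show ?thesis by (rule that(1))
next
  case False
  then have "gadget_coordinate m L x i = gadget_coordinate m L (\<lambda>_. 0) i" for x
    by (auto simp: gadget_coordinate_def gadget_def)
  then show ?thesis by (rule that(2))
qed

text \<open>Its zeros are the inputs that encode a configuration with \<open>B = 1\<close>. The free
  parameters are read off the input itself: for \<open>k\<close> in \<open>{1..m}\<close> the
  abscissa is coordinate \<open>2 * k\<close>, whose term vanishes identically.\<close>

definition slice :: "nat \<Rightarrow> nat \<Rightarrow> (nat \<Rightarrow> real) \<Rightarrow> real" where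
  "slice m L z =
     (\<Sum>i<2 * (m + L + 3) + 1. (z i - gadget_coordinate m L (\<lambda>k. z (2 * k)) i)\<^sup>2)"

lemma poly_fun_slice: "poly_fun (2 * (m + L + 3) + 1) 6 (slice m L)"
  unfolding slice_def[abs_def]
proof (intro poly_fun_sum poly_fun_square poly_fun_diff)
  fix i assume i: "i \<in> {..<2 * (m + L + 3) + 1}"
  show "poly_fun (2 * (m + L + 3) + 1) 3 (\<lambda>z. z i)" using i by (intro poly_fun_var) auto
  show "poly_fun (2 * (m + L + 3) + 1) 3 (\<lambda>z. gadget_coordinate m L (\<lambda>k. z (2 * k)) i)"
  proof (cases i rule: gadget_coordinate_cases[of m _ L])
    case (1 k)
    then show ?thesis by (auto intro!: poly_fun_var)
  next
    case (2 c)
    then show ?thesis by (simp add: poly_fun_const)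
  qed
qed

lemma slice_eq_0_iff:
  "slice m L z = 0 \<longleftrightarrow>
    (\<forall>i<2 * (m + L + 3) + 1. z i = gadget_coordinate m L (\<lambda>k. z (2 * k)) i)"
  unfolding slice_def by (subst sum_nonneg_eq_0_iff) auto

text \<open>Movable point \<open>k\<close> lies strictly between the intervals of YES-positions
  around the fixed abscissae number \<open>f k\<close> and \<open>f k + 1\<close>.\<close>

definition cell :: "nat \<Rightarrow> nat \<Rightarrow> (nat \<Rightarrow> nat) \<Rightarrow> (nat \<Rightarrow> real) set" where
  "cell m L f = {z. \<forall>k\<in>{1..m}. gap m L * real (f k) + radius m L k < z (2 * k) \<and>
     z (2 * k) < gap m L * (real (f k) + 1) - radius m L k}"

definition closed_cell :: "nat \<Rightarrow> nat \<Rightarrow> (nat \<Rightarrow> nat) \<Rightarrow> (nat \<Rightarrow> real) set" where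
  "closed_cell m L f = {z. \<forall>k\<in>{1..m}. gap m L * real (f k) + radius m L k \<le> z (2 * k) \<and>
     z (2 * k) \<le> gap m L * (real (f k) + 1) - radius m L k}"

text \<open>The \<open>L\<close> fixed abscissae leave \<open>L - 1\<close> gaps, whence the index
  set. Distinct index functions differ at some \<open>k\<close>, where their open intervals are
  disjoint.\<close>

lemma cylinder_regions_cell:
  "cylinder_regions (2 * (m + L + 3) + 1) (cell m L) (closed_cell m L)
     (\<Pi>\<^sub>E k\<in>{1..m}. {..<L - 1})"
proof
  let ?I = "\<Pi>\<^sub>E k\<in>{1..m}. {..<L - 1}"
  show "finite ?I" by (simp add: finite_PiE)
  have cont: "continuous_on UNIV (\<lambda>z :: nat \<Rightarrow> real. z i)" for i
    by (rule continuous_on_product_coordinates)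
  show "open (cell m L f)" for f
    unfolding cell_def Collect_ball_eq
    by (intro open_INT finite_atLeastAtMost ballI open_Collect_conj open_Collect_less cont continuous_on_const)
  show "closed (closed_cell m L f)" for f
    unfolding closed_cell_def Collect_ball_eq
    by (intro closed_INT ballI closed_Collect_conj closed_Collect_le cont continuous_on_const)
  show "cell m L f \<subseteq> closed_cell m L f" for f
    unfolding cell_def closed_cell_def by (intro Collect_mono impI ballI conjI less_imp_le) simp_all
  show "disjoint_family_on (cell m L) ?I"
    unfolding disjoint_family_on_def
  proof (intro ballI impI, rule ccontr)
    fix f h assume fh: "f \<in> ?I" "h \<in> ?I" "f \<noteq> h" "cell m L f \<inter> cell m L h \<noteq> {}"
    then obtain z where z: "z \<in> cell m L f" "z \<in> cell m L h" by blast
    have "f k = h k" if k: "k \<in> {1..m}" for k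
    proof -
      have lt: "real a < real b + 1"
        if "gap m L * real a + radius m L k < t" "t < gap m L * (real b + 1) - radius m L k" for a b t
      proof -
        have "gap m L * real a < gap m L * (real b + 1)"
          using that radius_pos[of m L k] by linarith
        then show ?thesis using gap_pos[of m L] by simp
      qed
      have "gap m L * real (f k) + radius m L k < z (2 * k)"
        "z (2 * k) < gap m L * (real (f k) + 1) - radius m L k"
        "gap m L * real (h k) + radius m L k < z (2 * k)"
        "z (2 * k) < gap m L * (real (h k) + 1) - radius m L k"
        using z k by (simp_all add: cell_def)
      then have "real (f k) < real (h k) + 1" "real (h k) < real (f k) + 1"
        using lt by blast+
      then show ?thesis by linarith
    qed
    then have "f = h" by (rule PiE_ext[OF fh(1,2)])
    then show False using fh(3) by simp
  qed
  show "z' \<in> cell m L f"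
    if "z \<in> cell m L f" "\<And>i. i < 2 * (m + L + 3) + 1 \<Longrightarrow> z i = z' i" for f z z'
  proof -
    have "z' (2 * k) = z (2 * k)" if "k \<in> {1..m}" for k
      using \<open>\<And>i. i < 2 * (m + L + 3) + 1 \<Longrightarrow> z i = z' i\<close>[of "2 * k"] that by auto
    then show ?thesis using that(1) unfolding cell_def by simp
  qed
qed

text \<open>\<open>decides_bpt\<close> speaks of distinct points; \<open>distinct_gadget\<close>
  provides these throughout the slice, on the boundaries of cells too.\<close>

lemma run_act_gadget:
  assumes T: "decides_bpt (m + L + 3) T" and z: "slice m L z = 0"
  shows "run_act T (map z [0..<2 * (m + L + 3) + 1]) \<longleftrightarrow>
    bottleneck_pyramidal (map (gadget m L (\<lambda>k. z (2 * k))) [0..<m + L + 3]) 1"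
proof -
  define ps where "ps = map (gadget m L (\<lambda>k. z (2 * k))) [0..<m + L + 3]"
  have "map z [0..<2 * (m + L + 3) + 1] = encode_input ps 1"
    unfolding ps_def by (rule encode_gadget) (use z slice_eq_0_iff in blast)
  moreover have "distinct ps" unfolding ps_def by (rule distinct_gadget)
  moreover have "length ps = m + L + 3" by (simp add: ps_def)
  ultimately show ?thesis
    using T unfolding decides_bpt_def ps_def[symmetric] by simp
qed

text \<open>In the middle of a gap every fixed abscissa is at least \<open>gap m L / 2\<close> away,
  which exceeds the radius.\<close>

lemma cell_centre:
  fixes f :: "nat \<Rightarrow> nat" and m L :: nat
  defines "z \<equiv> gadget_coordinate m L (\<lambda>k. gap m L * (real (f k) + 1 / 2))"
  shows "slice m L z = 0" "z \<in> cell m L f"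
    "\<not> bottleneck_pyramidal (map (gadget m L (\<lambda>k. z (2 * k))) [0..<m + L + 3]) 1"
proof -
  have zk: "z (2 * k) = gap m L * (real (f k) + 1 / 2)" if "k \<in> {1..m}" for k
    using that by (simp add: z_def gadget_coordinate_def gadget_def)
  have "gadget_coordinate m L (\<lambda>k. z (2 * k)) i = z i" for i
  proof (cases i rule: gadget_coordinate_cases[of m _ L])
    case (1 k)
    then show ?thesis by simp
  next
    case (2 c)
    then show ?thesis by (simp add: z_def)
  qed
  then show "slice m L z = 0" unfolding slice_eq_0_iff by simp
  have r: "radius m L k < gap m L / 2" if "k \<in> {1..m}" for k
    using that radius_less by simp
  show "z \<in> cell m L f"
    unfolding cell_def using zk r by (auto simp: distrib_left)
  have "\<not> \<bar>z (2 * k) - gap m L * real j\<bar> \<le> radius m L k" if k: "k \<in> {1..m}" for k j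
  proof -
    have "z (2 * k) - gap m L * real j = gap m L * (real (f k) - real j + 1 / 2)"
      using zk[OF k] by (simp add: algebra_simps)
    then have "\<bar>z (2 * k) - gap m L * real j\<bar> = gap m L * \<bar>real (f k) - real j + 1 / 2\<bar>"
      using gap_pos[of m L] by (simp add: abs_mult)
    \<comment> \<open>A half-integer has absolute value at least 1/2.\<close>
    moreover have "1 / 2 \<le> \<bar>real (f k) - real j + 1 / 2\<bar>"
      by (cases "j \<le> f k") auto
    then have "gap m L * (1 / 2) \<le> gap m L * \<bar>real (f k) - real j + 1 / 2\<bar>"
      using gap_pos[of m L] by (intro mult_left_mono) auto
    ultimately show ?thesis using r[OF k] by linarith
  qed
  then show "\<not> bottleneck_pyramidal (map (gadget m L (\<lambda>k. z (2 * k))) [0..<m + L + 3]) 1"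
    using bottleneck_gadget_imp_close[of m L "\<lambda>k. z (2 * k)"] by blast
qed

text \<open>Some movable abscissa is at distance exactly \<open>radius m L k\<close> from a fixed
  one, and closeness is a weak inequality.\<close>

lemma cell_boundary:
  assumes m: "2 \<le> m" and L: "2 \<le> L" and f: "\<And>k. k \<in> {1..m} \<Longrightarrow> f k < L - 1"
    and z: "z \<in> closed_cell m L f - cell m L f"
  shows "bottleneck_pyramidal (map (gadget m L (\<lambda>k. z (2 * k))) [0..<m + L + 3]) 1"
proof -
  have bounds: "gap m L * real (f k) + radius m L k \<le> z (2 * k)"
    "z (2 * k) \<le> gap m L * (real (f k) + 1) - radius m L k" if "k \<in> {1..m}" for k
    using z that by (auto simp: closed_cell_def)
  have x: "0 \<le> z (2 * k) \<and> z (2 * k) \<le> 1 / 10" if k: "k \<in> {1..m}" for k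
  proof -
    have "real (f k) + 1 \<le> real L" using f[OF k] by linarith
    then have "gap m L * (real (f k) + 1) \<le> gap m L * real L"
      using gap_pos[of m L] by (intro mult_left_mono) auto
    moreover have "0 \<le> gap m L * real (f k)" using gap_pos[of m L] by simp
    ultimately show ?thesis
      using bounds[OF k] radius_pos[of m L k] gap_le[of m L] by linarith
  qed
  obtain k where k: "k \<in> {1..m}" and "\<not> (gap m L * real (f k) + radius m L k < z (2 * k) \<and>
      z (2 * k) < gap m L * (real (f k) + 1) - radius m L k)"
    using z unfolding cell_def by blast
  then have on_bd: "z (2 * k) = gap m L * real (f k) + radius m L k \<or>
     z (2 * k) = gap m L * (real (f k) + 1) - radius m L k"
    using bounds[OF k] by linarith
  note yes = close_imp_bottleneck_gadget[OF m L, of "\<lambda>k. z (2 * k)", OF x k]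
  have r: "0 \<le> radius m L k" using radius_pos[of m L k] by simp
  from on_bd show ?thesis
  proof
    assume "z (2 * k) = gap m L * real (f k) + radius m L k"
    then have "\<bar>z (2 * k) - gap m L * real (f k)\<bar> \<le> radius m L k" using r by simp
    then show ?thesis using f[OF k] by (intro yes[of "f k"]) simp_all
  next
    \<comment> \<open>The right end belongs to the next fixed point, which exists because
      \<open>f k < L - 1\<close>.\<close>
    assume "z (2 * k) = gap m L * (real (f k) + 1) - radius m L k"
    then have "\<bar>z (2 * k) - gap m L * real (Suc (f k))\<bar> \<le> radius m L k"
      using r by (simp add: algebra_simps)
    then show ?thesis using f[OF k] by (intro yes[of "Suc (f k)"]) simp_all
  qed
qed

lemma cells_le_act_depth:
  assumes m: "2 \<le> m" and L: "2 \<le> L" and T: "decides_bpt (m + L + 3) T"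
  shows "(L - 1) ^ m \<le> 3 ^ act_depth T * 7 ^ (2 * (m + L + 3) + 1 + 2 * act_depth T)"
proof -
  let ?I = "\<Pi>\<^sub>E k\<in>{1..m}. {..<L - 1}"
  let ?M = "2 * (m + L + 3) + 1"
  let ?v = "\<lambda>f. gadget_coordinate m L (\<lambda>k. gap m L * (real (f k) + 1 / 2))"
  interpret cylinder_regions ?M "cell m L" "closed_cell m L" ?I
    by (rule cylinder_regions_cell)
  \<comment> \<open>The invariant at the root: the computed values are the inputs, and the cell
    centres are the rejected points.\<close>
  have "separates T ?M (slice m L) [0..<?M] ?I ?v"
    unfolding separates_def
  proof (intro conjI ballI allI impI)
    show "0 \<le> slice m L z" for z unfolding slice_def by (intro sum_nonneg) simp
    show "poly_fun ?M 6 (slice m L)" by (rule poly_fun_slice)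
    show "set [0..<?M] \<subseteq> {..<?M}" by auto
  next
    fix f
    show "?v f \<in> cell m L f" "slice m L (?v f) = 0" by (rule cell_centre)+
    then show "\<not> run_act T (map (?v f) [0..<?M])"
      using run_act_gadget[OF T] cell_centre(3) by blast
  next
    fix f z assume f: "f \<in> ?I" and z: "z \<in> closed_cell m L f - cell m L f" "slice m L z = 0"
    have "f k < L - 1" if "k \<in> {1..m}" for k using f that by auto
    then show "run_act T (map z [0..<?M])"
      using run_act_gadget[OF T z(2)] cell_boundary[OF m L _ z(1)] by blast
  qed simp_all
  then have "card ?I \<le> 3 ^ act_depth T * 7 ^ (?M + 2 * act_depth T)"
    by (rule card_separates_le)
  then show ?thesis by (simp add: card_PiE)
qed

theorem theorem13:
  shows "\<exists>c>0. \<exists>N. \<forall>n\<ge>N. \<forall>T. decides_bpt n T \<longrightarrow>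
           real (act_depth T) \<ge> c * real n * ln (real n)"
proof (intro exI conjI allI impI)
  \<comment> \<open>The estimates below give \<open>n * ln n / 6 \<le> 14 * h + 18 * n\<close>. For
    \<open>ln n \<ge> 216 = 12 * 18\<close> the last term is at most \<open>n * ln n / 12\<close>,
    which leaves the constant \<open>1 / (12 * 14)\<close>.\<close>
  show "(1 / 168 :: real) > 0" by simp
  fix n T assume n: "nat \<lceil>exp 216 :: real\<rceil> \<le> n" and T: "decides_bpt n T"
  define h where "h = act_depth T"
  have "exp 216 \<le> real n" using n by linarith
  then have ln_n: "216 \<le> ln (real n)"
    by (metis exp_gt_zero ln_exp ln_le_cancel_iff less_le_trans)
  have "(217 :: real) \<le> exp 216" using exp_ge_add_one_self[of 216] by simp
  then have n217: "217 \<le> n" using \<open>exp 216 \<le> real n\<close> by linarith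
  \<comment> \<open>The connector, start and end point take 3 of the \<open>n\<close> points; the
    rest is divided about evenly.\<close>
  define m where "m = n div 2"
  define L where "L = n - m - 3"
  have mL: "2 \<le> m" "2 \<le> L" "n = m + L + 3" using n217 by (auto simp: m_def L_def)
  have "3 * m \<ge> n" "4 * (L - 1) \<ge> n" using n217 by (auto simp: m_def L_def)
  then have m_ge: "real n / 3 \<le> real m" and L_ge: "real n / 4 \<le> real (L - 1)" by linarith+
  have "(L - 1) ^ m \<le> 3 ^ h * 7 ^ (2 * n + 1 + 2 * h)"
    using cells_le_act_depth[OF mL(1,2)] T mL(3) by (simp add: h_def)
  then have "real ((L - 1) ^ m) \<le> real (3 ^ h * 7 ^ (2 * n + 1 + 2 * h))"
    by (simp only: of_nat_le_iff)
  then have "real (L - 1) ^ m \<le> 3 ^ h * 7 ^ (2 * n + 1 + 2 * h)" by simp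
  moreover have "real (L - 1) > 0" using mL by simp
  ultimately have "ln (real (L - 1) ^ m) \<le> ln (3 ^ h * 7 ^ (2 * n + 1 + 2 * h))"
    by (subst ln_le_cancel_iff) auto
  then have main: "real m * ln (real (L - 1)) \<le> real h * ln 3 + real (2 * n + 1 + 2 * h) * ln 7"
    using \<open>real (L - 1) > 0\<close> by (simp add: ln_mult ln_realpow distrib_right)
  \<comment> \<open>Crude bounds from \<open>ln x \<le> x - 1\<close>.\<close>
  have "ln 3 \<le> (2 :: real)" "ln 7 \<le> (6 :: real)"
    using ln_le_minus_one[of "3 :: real"] ln_le_minus_one[of "7 :: real"] by simp_all
  then have "real h * ln 3 + real (2 * n + 1 + 2 * h) * ln 7 \<le> real h * 2 + real (2 * n + 1 + 2 * h) * 6"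
    by (intro add_mono mult_left_mono) auto
  also have "\<dots> \<le> 14 * real h + 18 * real n" using n217 by simp
  finally have upper: "real m * ln (real (L - 1)) \<le> 14 * real h + 18 * real n" using main by linarith
  \<comment> \<open>Comparing \<open>L - 1\<close> with the square root of \<open>n\<close> costs
    only a factor 2 in the logarithm.\<close>
  have "sqrt (real n) \<le> real n / 4"
  proof (rule real_le_lsqrt)
    have "16 * real n \<le> real n * real n" using n217 by (intro mult_right_mono) auto
    then show "real n \<le> (real n / 4)\<^sup>2" by (simp add: power2_eq_square)
  qed auto
  then have "sqrt (real n) \<le> real (L - 1)" using L_ge by linarith
  moreover have "sqrt (real n) > 0" using n217 by simp
  ultimately have "ln (sqrt (real n)) \<le> ln (real (L - 1))"
    by (rule ln_mono)
  then have "ln (real n) / 2 \<le> ln (real (L - 1))" using n217 by (simp add: ln_sqrt)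
  then have "real n / 3 * (ln (real n) / 2) \<le> real m * ln (real (L - 1))"
    using m_ge ln_n by (intro mult_mono) auto
  then have "real n * ln (real n) / 6 \<le> 14 * real h + 18 * real n" using upper by simp
  moreover have "real n * 216 \<le> real n * ln (real n)" using ln_n by (intro mult_left_mono) auto
  ultimately have "real n * ln (real n) \<le> 168 * real h" by linarith
  then show "1 / 168 * real n * ln (real n) \<le> real (act_depth T)" by (simp add: h_def)
qed

end
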